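(* Let $n\ge2$, let $\rho$ be a generic irreducible smooth representation of $G_{n+1}$ and let $\eta$ be any irreducible smooth representation of $G_{n-1}$. Then: (1) $(\rho\times\eta)_{N,\psi}\ne0$, and (2) $(\eta\times\rho)_{N,\psi}\ne0$.
   Context: $F$ is a non-archimedean local field or a finite field, $\mathcal M_n$ is the space of $n\times n$ matrices over $F$, $G_n=GL_n(F)$. $\psi_0$ is a fixed non-trivial additive character of $F$. Let $U_m$ be the group of upper triangular unipotent matrices in $G_m$ and $\theta$ the character $\theta(u)=\psi_0\left(\sum_{i=1}^{m-1}u_{i,i+1}\right)$ of $U_m$; an irreducible smooth complex representation $\pi$ of $G_m$ is generic if $\mathrm{Hom}_{U_m}(\pi,\theta)\ne0$. The symbol $\times$ denotes normalized parabolic induction from the standard block upper triangular parabolic subgroup (of type $(n+1,n-1)$ in (1), $(n-1,n+1)$ in (2)) of $G_{2n}$. $N=\left\{\begin{pmatrix} I_n&x\\0&I_n\end{pmatrix}:x\in\mathcal M_n\right\}\subset G_{2n}$, $\psi\begin{pmatrix} I_n&x\\0&I_n\end{pmatrix}=\psi_0(\mathrm{tr}(x))$, and for a smooth representation $(\pi,V)$ of $G_{2n}$, $\pi_{N,\psi}$ is the space $V/\langle\pi(u)v-\psi(u)v:u\in N,v\in V\rangle$. *)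

theory Defs
  imports
    "Jordan_Normal_Form.Determinant"
    "HOL-Analysis.Function_Topology"
    "HOL-Analysis.Abstract_Metric_Spaces"
    "HOL-Library.Poly_Mapping"
    "HOL-Library.Function_Algebras"
begin

section \<open>Complex vector spaces\<close>

class complex_vector = ab_group_add +
  fixes scaleC :: "complex \<Rightarrow> 'a \<Rightarrow> 'a"  (infixr "*\<^sub>C" 75)
  assumes scaleC_add_right: "a *\<^sub>C (x + y) = a *\<^sub>C x + a *\<^sub>C y"
    and scaleC_add_left: "(a + b) *\<^sub>C x = a *\<^sub>C x + b *\<^sub>C x"
    and scaleC_scaleC: "a *\<^sub>C b *\<^sub>C x = (a * b) *\<^sub>C x"
    and scaleC_one: "1 *\<^sub>C x = x"

global_interpretation cvec: vector_space "scaleC :: complex \<Rightarrow> 'a \<Rightarrow> 'a::complex_vector"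
  by standard (rule scaleC_add_right scaleC_add_left scaleC_scaleC scaleC_one)+

abbreviation clinear :: "('a::complex_vector \<Rightarrow> 'b::complex_vector) \<Rightarrow> bool"
  where "clinear \<equiv> Vector_Spaces.linear scaleC scaleC"

lemma clinearI:
  assumes "\<And>x y. f (x + y) = f x + f y" "\<And>c x. f (c *\<^sub>C x) = c *\<^sub>C f x"
  shows "clinear f"
  by (intro Vector_Spaces.linear.intro module_hom.intro module_hom_axioms.intro
      cvec.vector_space_axioms cvec.module_axioms assms)

lemma clinear_add: "clinear f \<Longrightarrow> f (x + y) = f x + f y"
  by (simp add: Vector_Spaces.linear_def module_hom_def module_hom_axioms_def)

lemma clinear_scale: "clinear f \<Longrightarrow> f (c *\<^sub>C x) = c *\<^sub>C f x"
  by (simp add: Vector_Spaces.linear_def module_hom_def module_hom_axioms_def)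

instantiation complex :: complex_vector
begin
definition scaleC_complex :: "complex \<Rightarrow> complex \<Rightarrow> complex"
  where "scaleC_complex a x = a * x"
instance by standard (simp_all add: scaleC_complex_def algebra_simps)
end

instantiation "fun" :: (type, complex_vector) complex_vector
begin
definition scaleC_fun :: "complex \<Rightarrow> ('a \<Rightarrow> 'b) \<Rightarrow> 'a \<Rightarrow> 'b"
  where "scaleC_fun c f = (\<lambda>x. c *\<^sub>C f x)"
instance
  by standard (simp_all add: scaleC_fun_def fun_eq_iff scaleC_add_right scaleC_add_left
      scaleC_scaleC scaleC_one)
end

instantiation poly_mapping :: (type, complex_vector) complex_vector
begin
definition scaleC_poly_mapping :: "complex \<Rightarrow> ('a \<Rightarrow>\<^sub>0 'b) \<Rightarrow> 'a \<Rightarrow>\<^sub>0 'b"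
  where "scaleC_poly_mapping c p = Poly_Mapping.map (scaleC c) p"

lemma lookup_scaleC: "Poly_Mapping.lookup (c *\<^sub>C p) k = c *\<^sub>C Poly_Mapping.lookup p k" for p :: "'a \<Rightarrow>\<^sub>0 'b"
  by (auto simp: scaleC_poly_mapping_def Poly_Mapping.map.rep_eq when_def)

instance
  by standard (simp_all add: poly_mapping_eq_iff fun_eq_iff lookup_scaleC lookup_add
      scaleC_add_right scaleC_add_left scaleC_scaleC scaleC_one)
end


section \<open>Tensor products\<close>

text \<open>The tensor product is the free complex vector space on \<open>V \<times> W\<close> modulo
  the bilinearity relations.\<close>

definition tensor_relations ::
  "('v::complex_vector \<times> 'w::complex_vector \<Rightarrow>\<^sub>0 complex) set"
  where "tensor_relations = cvec.span (
     {Poly_Mapping.single (v + v', w) 1 - Poly_Mapping.single (v, w) 1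
        - Poly_Mapping.single (v', w) 1 | v v' w. True}
   \<union> {Poly_Mapping.single (v, w + w') 1 - Poly_Mapping.single (v, w) 1
        - Poly_Mapping.single (v, w') 1 | v w w'. True}
   \<union> {Poly_Mapping.single (c *\<^sub>C v, w) 1 - c *\<^sub>C Poly_Mapping.single (v, w) 1 | c v w. True}
   \<union> {Poly_Mapping.single (v, c *\<^sub>C w) 1 - c *\<^sub>C Poly_Mapping.single (v, w) 1 | c v w. True})"

definition tensor_rel ::
  "('v::complex_vector \<times> 'w::complex_vector \<Rightarrow>\<^sub>0 complex)
     \<Rightarrow> ('v \<times> 'w \<Rightarrow>\<^sub>0 complex) \<Rightarrow> bool"
  where "tensor_rel p q \<longleftrightarrow> p - q \<in> tensor_relations"

lemma subspace_tensor_relations: "cvec.subspace tensor_relations"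
  unfolding tensor_relations_def by (rule cvec.subspace_span)

lemma equivp_tensor_rel: "equivp tensor_rel"
proof (rule equivpI)
  show "reflp tensor_rel"
    by (auto simp: reflp_def tensor_rel_def cvec.subspace_0 subspace_tensor_relations)
  show "symp tensor_rel"
    unfolding symp_def tensor_rel_def
    using cvec.subspace_neg[OF subspace_tensor_relations] by (metis minus_diff_eq)
  show "transp tensor_rel"
    unfolding transp_def tensor_rel_def
    using cvec.subspace_add[OF subspace_tensor_relations] by fastforce
qed

quotient_type (overloaded) ('v, 'w) tensor =
  "'v::complex_vector \<times> 'w::complex_vector \<Rightarrow>\<^sub>0 complex" / tensor_rel
  by (rule equivp_tensor_rel)

instantiation tensor :: (complex_vector, complex_vector) complex_vector
begin

lift_definition zero_tensor :: "('a, 'b) tensor" is 0 .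

lift_definition plus_tensor :: "('a, 'b) tensor \<Rightarrow> ('a, 'b) tensor \<Rightarrow> ('a, 'b) tensor" is "(+)"
  unfolding tensor_rel_def add_diff_add
  by (rule cvec.subspace_add[OF subspace_tensor_relations])

lift_definition uminus_tensor :: "('a, 'b) tensor \<Rightarrow> ('a, 'b) tensor" is uminus
  unfolding tensor_rel_def minus_diff_minus
  by (rule cvec.subspace_neg[OF subspace_tensor_relations])

lift_definition minus_tensor :: "('a, 'b) tensor \<Rightarrow> ('a, 'b) tensor \<Rightarrow> ('a, 'b) tensor" is "(-)"
  unfolding tensor_rel_def
  by (drule (1) cvec.subspace_diff[OF subspace_tensor_relations]) (simp add: algebra_simps)

lift_definition scaleC_tensor :: "complex \<Rightarrow> ('a, 'b) tensor \<Rightarrow> ('a, 'b) tensor" is scaleC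
  unfolding tensor_rel_def cvec.scale_right_diff_distrib[symmetric]
  by (rule cvec.subspace_scale[OF subspace_tensor_relations])

instance
  by standard (transfer, simp add: tensor_rel_def algebra_simps scaleC_add_right
    scaleC_add_left scaleC_scaleC scaleC_one cvec.subspace_0 subspace_tensor_relations)+

end

lift_definition tensor :: "'v::complex_vector \<Rightarrow> 'w::complex_vector \<Rightarrow> ('v, 'w) tensor"
  (infixr "\<otimes>\<^sub>C" 70)
  is "\<lambda>v w. Poly_Mapping.single (v, w) 1" .

definition cbilinear :: "('v::complex_vector \<Rightarrow> 'w::complex_vector \<Rightarrow> 'x::complex_vector) \<Rightarrow> bool"
  where "cbilinear h \<longleftrightarrow> (\<forall>v. clinear (h v)) \<and> (\<forall>w. clinear (\<lambda>v. h v w))"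

lemma cbilinear_tensor: "cbilinear (\<otimes>\<^sub>C)"
proof -
  have *: "x \<in> tensor_relations"
    if "x \<in> {Poly_Mapping.single (v + v', w) 1 - Poly_Mapping.single (v, w) 1
        - Poly_Mapping.single (v', w) 1 | v v' w. True}
   \<union> {Poly_Mapping.single (v, w + w') 1 - Poly_Mapping.single (v, w) 1
        - Poly_Mapping.single (v, w') 1 | v w w'. True}
   \<union> {Poly_Mapping.single (c *\<^sub>C v, w) 1 - c *\<^sub>C Poly_Mapping.single (v, w) 1 | c v w. True}
   \<union> {Poly_Mapping.single (v, c *\<^sub>C w) 1 - c *\<^sub>C Poly_Mapping.single (v, w) 1 | c v w. True}"
    for x :: "'a \<times> 'b \<Rightarrow>\<^sub>0 complex"
    using that unfolding tensor_relations_def by (rule cvec.span_base)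
  show ?thesis
    unfolding cbilinear_def
    by (intro conjI allI clinearI; transfer; unfold tensor_rel_def diff_diff_eq[symmetric]; rule *; blast)
qed

text \<open>The linear map \<open>V \<otimes> W \<rightarrow> X\<close> induced by a bilinear map \<open>h\<close>, evaluated on a
  chosen representative; see \<open>clinear_tensor_lift\<close> and \<open>tensor_lift_tensor\<close>.\<close>

definition free_lift :: "('v \<Rightarrow> 'w \<Rightarrow> 'x) \<Rightarrow> ('v \<times> 'w \<Rightarrow>\<^sub>0 complex) \<Rightarrow> 'x::complex_vector"
  where "free_lift h p = (\<Sum>(v, w)\<in>Poly_Mapping.keys p. Poly_Mapping.lookup p (v, w) *\<^sub>C h v w)"

definition tensor_lift ::
  "('v \<Rightarrow> 'w \<Rightarrow> 'x) \<Rightarrow> ('v::complex_vector, 'w::complex_vector) tensor \<Rightarrow> 'x::complex_vector"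
  where "tensor_lift h t = free_lift h (rep_tensor t)"

lemma free_lift_superset:
  assumes "finite A" "Poly_Mapping.keys p \<subseteq> A"
  shows "free_lift h p = (\<Sum>(v, w)\<in>A. Poly_Mapping.lookup p (v, w) *\<^sub>C h v w)"
  unfolding free_lift_def
  by (rule sum.mono_neutral_left) (use assms in \<open>auto simp: in_keys_iff\<close>)

lemma clinear_free_lift: "clinear (free_lift h)"
proof (rule clinearI)
  fix p q :: "'a \<times> 'b \<Rightarrow>\<^sub>0 complex" and c
  let ?A = "Poly_Mapping.keys p \<union> Poly_Mapping.keys q"
  show "free_lift h (p + q) = free_lift h p + free_lift h q"
    by (simp add: free_lift_superset[of ?A] Poly_Mapping.keys_add lookup_add
        scaleC_add_left sum.distrib[symmetric] case_prod_unfold)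
  have "Poly_Mapping.keys (c *\<^sub>C p) \<subseteq> Poly_Mapping.keys p"
    by (auto simp: in_keys_iff lookup_scaleC)
  then show "free_lift h (c *\<^sub>C p) = c *\<^sub>C free_lift h p"
    by (simp add: free_lift_superset[of "Poly_Mapping.keys p"] lookup_scaleC
        cvec.scale_sum_right case_prod_unfold scaleC_scaleC scaleC_complex_def)
qed

lemma free_lift_single: "free_lift h (Poly_Mapping.single (v, w) c) = c *\<^sub>C h v w"
  by (simp add: free_lift_superset[of "{(v, w)}"])

lemma free_lift_relations:
  assumes "cbilinear h" "p \<in> tensor_relations"
  shows "free_lift h p = 0"
proof -
  interpret L: Vector_Spaces.linear scaleC scaleC "free_lift h" by (rule clinear_free_lift)
  have h: "clinear (h v)" "clinear (\<lambda>v. h v w)" for v w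
    using assms(1) by (auto simp: cbilinear_def)
  show ?thesis
    using assms(2) unfolding tensor_relations_def
    by (rule L.eq_0_on_span[rotated])
      (auto simp: L.diff L.scale free_lift_single scaleC_one
        clinear_add[OF h(1)] clinear_add[OF h(2)] clinear_scale[OF h(1)] clinear_scale[OF h(2)])
qed

lemma tensor_lift_abs:
  assumes "cbilinear h"
  shows "tensor_lift h (abs_tensor p) = free_lift h p"
proof -
  interpret L: Vector_Spaces.linear scaleC scaleC "free_lift h" by (rule clinear_free_lift)
  have "tensor_rel (rep_tensor (abs_tensor p)) p"
    using Quotient_rep_abs[OF Quotient_tensor] equivp_reflp[OF equivp_tensor_rel] by metis
  then show ?thesis
    using free_lift_relations[OF assms] by (fastforce simp: tensor_lift_def tensor_rel_def L.diff)
qed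

lemma clinear_tensor_lift:
  assumes "cbilinear h"
  shows "clinear (tensor_lift h)"
proof (rule clinearI)
  fix s t :: "('a, 'b) tensor" and c
  obtain p q where [simp]: "s = abs_tensor p" "t = abs_tensor q"
    by (metis Quotient_abs_rep[OF Quotient_tensor])
  show "tensor_lift h (s + t) = tensor_lift h s + tensor_lift h t"
    by (simp add: plus_tensor.abs_eq tensor_lift_abs[OF assms] clinear_add[OF clinear_free_lift])
  show "tensor_lift h (c *\<^sub>C s) = c *\<^sub>C tensor_lift h s"
    by (simp add: scaleC_tensor.abs_eq tensor_lift_abs[OF assms] clinear_scale[OF clinear_free_lift])
qed

lemma tensor_lift_tensor: "cbilinear h \<Longrightarrow> tensor_lift h (v \<otimes>\<^sub>C w) = h v w"
  by (simp add: tensor.abs_eq tensor_lift_abs free_lift_single scaleC_one)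

definition tensor_map ::
  "('v::complex_vector \<Rightarrow> 'v) \<Rightarrow> ('w::complex_vector \<Rightarrow> 'w) \<Rightarrow> ('v, 'w) tensor \<Rightarrow> ('v, 'w) tensor"
  where "tensor_map A B = tensor_lift (\<lambda>v w. A v \<otimes>\<^sub>C B w)"

lemma
  assumes "clinear A" "clinear B"
  shows clinear_tensor_map: "clinear (tensor_map A B)"
    and tensor_map_tensor: "tensor_map A B (v \<otimes>\<^sub>C w) = A v \<otimes>\<^sub>C B w"
proof -
  have t: "clinear ((\<otimes>\<^sub>C) x)" "clinear (\<lambda>x. x \<otimes>\<^sub>C y)" for x :: 'a and y :: 'b
    using cbilinear_tensor by (auto simp: cbilinear_def)
  have "cbilinear (\<lambda>v w. A v \<otimes>\<^sub>C B w)"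
    unfolding cbilinear_def
    by (intro conjI allI clinearI)
      (simp_all add: clinear_add[OF t(1)] clinear_add[OF t(2)] clinear_scale[OF t(1)]
        clinear_scale[OF t(2)] clinear_add[OF assms(1)] clinear_add[OF assms(2)]
        clinear_scale[OF assms(1)] clinear_scale[OF assms(2)])
  then show "clinear (tensor_map A B)" "tensor_map A B (v \<otimes>\<^sub>C w) = A v \<otimes>\<^sub>C B w"
    by (simp_all add: tensor_map_def clinear_tensor_lift tensor_lift_tensor)
qed


section \<open>Local and finite fields\<close>

text \<open>The field carries its normalized absolute value \<open>av\<close>.  The residue field
  is \<open>{|x| \<le> 1} / {|x| < 1}\<close>, and normalized means that a uniformizer has absolute value
  \<open>1 / q\<close>, where \<open>q\<close> is the order of the residue field.\<close>

definition residue_field :: "('f::field \<Rightarrow> real) \<Rightarrow> 'f set set"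
  where "residue_field av =
    {x. av x \<le> 1} // {(x, y). av x \<le> 1 \<and> av y \<le> 1 \<and> av (x - y) < 1}"

definition nonarch_local_field :: "('f::field \<Rightarrow> real) \<Rightarrow> bool"
  where "nonarch_local_field av \<longleftrightarrow>
    (\<forall>x. 0 \<le> av x) \<and> (\<forall>x. av x = 0 \<longleftrightarrow> x = 0) \<and>
    (\<forall>x y. av (x * y) = av x * av y) \<and>
    (\<forall>x y. av (x + y) \<le> max (av x) (av y)) \<and>
    finite (residue_field av) \<and>
    av ` (UNIV - {0}) = range (\<lambda>k::int. real (card (residue_field av)) powi k) \<and>
    Metric_space.mcomplete UNIV (\<lambda>x y. av (x - y))"

text \<open>A finite field carries the trivial absolute value, hence the discrete topology and
  trivial modulus characters.\<close>

definition finite_field :: "('f::field \<Rightarrow> real) \<Rightarrow> bool"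
  where "finite_field av \<longleftrightarrow> finite (UNIV :: 'f set) \<and> av = (\<lambda>x. if x = 0 then 0 else 1)"

definition field_topology :: "('f::field \<Rightarrow> real) \<Rightarrow> 'f topology"
  where "field_topology av = Metric_space.mtopology UNIV (\<lambda>x y. av (x - y))"

definition nontrivial_additive_character :: "('f::field \<Rightarrow> real) \<Rightarrow> ('f \<Rightarrow> complex) \<Rightarrow> bool"
  where "nontrivial_additive_character av \<psi>\<^sub>0 \<longleftrightarrow>
    (\<forall>x y. \<psi>\<^sub>0 (x + y) = \<psi>\<^sub>0 x * \<psi>\<^sub>0 y) \<and> (\<forall>x. cmod (\<psi>\<^sub>0 x) = 1) \<and>
    continuous_map (field_topology av) euclidean \<psi>\<^sub>0 \<and> (\<exists>x. \<psi>\<^sub>0 x \<noteq> 1)"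


section \<open>Smooth representations of general linear groups\<close>

definition GL :: "nat \<Rightarrow> 'f::field mat set"
  where "GL m = {g \<in> carrier_mat m m. invertible_mat g}"

text \<open>The subspace topology from \<open>F\<^bsup>m \<times> m\<^esup>\<close>.\<close>

definition GL_topology :: "('f::field \<Rightarrow> real) \<Rightarrow> nat \<Rightarrow> 'f mat topology"
  where "GL_topology av m = pullback_topology (GL m)
    (\<lambda>g. restrict (\<lambda>ij. g $$ ij) ({..<m} \<times> {..<m}))
    (product_topology (\<lambda>_. field_topology av) ({..<m} \<times> {..<m}))"

definition smooth_vector ::
  "('f::field \<Rightarrow> real) \<Rightarrow> nat \<Rightarrow> ('f mat \<Rightarrow> 'v \<Rightarrow> 'v) \<Rightarrow> 'v \<Rightarrow> bool"
  where "smooth_vector av m \<pi> v \<longleftrightarrow> openin (GL_topology av m) {g \<in> GL m. \<pi> g v = v}"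

text \<open>A representation of \<open>GL m\<close> on the whole type \<open>'v\<close>; the values of \<open>\<pi>\<close> outside \<open>GL m\<close>
  are irrelevant.\<close>

definition smooth_rep ::
  "('f::field \<Rightarrow> real) \<Rightarrow> nat \<Rightarrow> ('f mat \<Rightarrow> 'v::complex_vector \<Rightarrow> 'v) \<Rightarrow> bool"
  where "smooth_rep av m \<pi> \<longleftrightarrow>
    (\<forall>g\<in>GL m. clinear (\<pi> g)) \<and>
    (\<forall>v. \<pi> (1\<^sub>m m) v = v) \<and>
    (\<forall>g\<in>GL m. \<forall>h\<in>GL m. \<forall>v. \<pi> (g * h) v = \<pi> g (\<pi> h v)) \<and>
    (\<forall>v. smooth_vector av m \<pi> v)"

definition irreducible_smooth_rep ::
  "('f::field \<Rightarrow> real) \<Rightarrow> nat \<Rightarrow> ('f mat \<Rightarrow> 'v::complex_vector \<Rightarrow> 'v) \<Rightarrow> bool"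
  where "irreducible_smooth_rep av m \<pi> \<longleftrightarrow>
    smooth_rep av m \<pi> \<and> (\<exists>v::'v. v \<noteq> 0) \<and>
    (\<forall>S. cvec.subspace S \<and> (\<forall>g\<in>GL m. \<forall>v\<in>S. \<pi> g v \<in> S) \<longrightarrow> S = {0} \<or> S = UNIV)"

definition unipotent_upper :: "nat \<Rightarrow> 'f::field mat set"
  where "unipotent_upper m =
    {u \<in> carrier_mat m m. upper_triangular u \<and> (\<forall>i<m. u $$ (i, i) = 1)}"

text \<open>Matrix indices start at 0, so the superdiagonal entries are \<open>u $$ (i, i + 1)\<close>
  for \<open>i < m - 1\<close>.\<close>

definition whittaker_character :: "('f::field \<Rightarrow> complex) \<Rightarrow> nat \<Rightarrow> 'f mat \<Rightarrow> complex"
  where "whittaker_character \<psi>\<^sub>0 m u = \<psi>\<^sub>0 (\<Sum>i<m - 1. u $$ (i, i + 1))"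

definition whittaker_functionals ::
  "('f::field \<Rightarrow> complex) \<Rightarrow> nat \<Rightarrow> ('f mat \<Rightarrow> 'v::complex_vector \<Rightarrow> 'v) \<Rightarrow> ('v \<Rightarrow> complex) set"
  where "whittaker_functionals \<psi>\<^sub>0 m \<pi> = {l. clinear l \<and>
    (\<forall>u\<in>unipotent_upper m. \<forall>v. l (\<pi> u v) = whittaker_character \<psi>\<^sub>0 m u * l v)}"

definition generic ::
  "('f::field \<Rightarrow> complex) \<Rightarrow> nat \<Rightarrow> ('f mat \<Rightarrow> 'v::complex_vector \<Rightarrow> 'v) \<Rightarrow> bool"
  where "generic \<psi>\<^sub>0 m \<pi> \<longleftrightarrow> whittaker_functionals \<psi>\<^sub>0 m \<pi> \<noteq> {0}"


section \<open>Normalized parabolic induction\<close>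

text \<open>The modulus character of the standard parabolic of type \<open>(a, b)\<close>: conjugation by
  \<open>diag g\<^sub>1 g\<^sub>2\<close> acts on its unipotent radical, the \<open>a \<times> b\<close> matrices, by
  \<open>x \<mapsto> g\<^sub>1 x g\<^sub>2\<^sup>-\<^sup>1\<close> and so scales Haar measure by \<open>|det g\<^sub>1|\<^sup>b |det g\<^sub>2|\<^sup>-\<^sup>a\<close>.\<close>

definition modulus :: "('f::field \<Rightarrow> real) \<Rightarrow> nat \<Rightarrow> nat \<Rightarrow> 'f mat \<Rightarrow> 'f mat \<Rightarrow> real"
  where "modulus av a b g\<^sub>1 g\<^sub>2 = av (det g\<^sub>1) ^ b / av (det g\<^sub>2) ^ a"

text \<open>Functions on \<open>GL m\<close> are represented by functions on all matrices vanishing outside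
  \<open>GL m\<close>.\<close>

definition right_translation :: "nat \<Rightarrow> 'f::field mat \<Rightarrow> ('f mat \<Rightarrow> 'x::zero) \<Rightarrow> 'f mat \<Rightarrow> 'x"
  where "right_translation m g f = (\<lambda>x. if x \<in> GL m then f (x * g) else 0)"

text \<open>The space of \<open>\<rho> \<times> \<eta>\<close>, induced from the block upper triangular parabolic of type
  \<open>(a, b)\<close>; the group \<open>GL (a + b)\<close> acts on it by \<open>right_translation (a + b)\<close>.\<close>

definition induced_space ::
  "('f::field \<Rightarrow> real) \<Rightarrow> nat \<Rightarrow> nat \<Rightarrow> ('f mat \<Rightarrow> 'v::complex_vector \<Rightarrow> 'v) \<Rightarrow>
    ('f mat \<Rightarrow> 'w::complex_vector \<Rightarrow> 'w) \<Rightarrow> ('f mat \<Rightarrow> ('v, 'w) tensor) set"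
  where "induced_space av a b \<rho> \<eta> = {f.
    (\<forall>g. g \<notin> GL (a + b) \<longrightarrow> f g = 0) \<and>
    (\<forall>g\<^sub>1\<in>GL a. \<forall>g\<^sub>2\<in>GL b. \<forall>x\<in>carrier_mat a b. \<forall>g\<in>GL (a + b).
       f (four_block_mat g\<^sub>1 x (0\<^sub>m b a) g\<^sub>2 * g) =
         complex_of_real (sqrt (modulus av a b g\<^sub>1 g\<^sub>2)) *\<^sub>C tensor_map (\<rho> g\<^sub>1) (\<eta> g\<^sub>2) (f g)) \<and>
    smooth_vector av (a + b) (right_translation (a + b)) f}"


section \<open>The twisted Jacquet module\<close>

definition jacquet_relations ::
  "('f::field \<Rightarrow> complex) \<Rightarrow> nat \<Rightarrow> 'v set \<Rightarrow> ('f mat \<Rightarrow> 'v \<Rightarrow> 'v) \<Rightarrow> 'v::complex_vector set"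
  where "jacquet_relations \<psi>\<^sub>0 n V \<pi> = cvec.span
    {\<pi> (four_block_mat (1\<^sub>m n) x (0\<^sub>m n n) (1\<^sub>m n)) v - \<psi>\<^sub>0 (\<Sum>i<n. x $$ (i, i)) *\<^sub>C v
      | x v. x \<in> carrier_mat n n \<and> v \<in> V}"

text \<open>The quotient of \<open>V\<close>, a space of a representation of \<open>GL (2 * n)\<close>, as a set of cosets.\<close>

definition twisted_jacquet ::
  "('f::field \<Rightarrow> complex) \<Rightarrow> nat \<Rightarrow> 'v set \<Rightarrow> ('f mat \<Rightarrow> 'v \<Rightarrow> 'v) \<Rightarrow> 'v::complex_vector set set"
  where "twisted_jacquet \<psi>\<^sub>0 n V \<pi> = (\<lambda>v. (+) v ` jacquet_relations \<psi>\<^sub>0 n V \<pi>) ` V"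

text \<open>The zero vector of the quotient is the coset \<open>jacquet_relations \<psi>\<^sub>0 n V \<pi>\<close>.\<close>

definition twisted_jacquet_nonzero ::
  "('f::field \<Rightarrow> complex) \<Rightarrow> nat \<Rightarrow> 'v set \<Rightarrow> ('f mat \<Rightarrow> 'v \<Rightarrow> 'v::complex_vector) \<Rightarrow> bool"
  where "twisted_jacquet_nonzero \<psi>\<^sub>0 n V \<pi> \<longleftrightarrow>
    (\<exists>\<xi>\<in>twisted_jacquet \<psi>\<^sub>0 n V \<pi>. \<xi> \<noteq> jacquet_relations \<psi>\<^sub>0 n V \<pi>)"

end

theory Submission
  imports Defs
begin

text \<open>Let \<open>P\<close> be the parabolic subgroup from which the representation is induced.  The reason for
  non-vanishing is the contribution of the open orbit, on the Grassmannian \<open>P \ GL (2 n)\<close>, of the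
  parabolic subgroup of type \<open>(n, n)\<close> with unipotent radical \<open>N\<close>.  Let \<open>P g\<close> be a point of it.  The
  stabilizer of \<open>P g\<close> in \<open>N\<close>, conjugated by \<open>g\<close>, acts on the inducing data through an abelian
  unipotent subgroup of dimension \<open>n\<close> in the factor \<open>GL (n + 1)\<close>, a row or a column; and for a suitable
  \<open>g\<close> the character \<open>\<psi>\<close> of the stabilizer becomes the Whittaker character.  So a Whittaker functional
  of \<open>\<rho>\<close>, tensored with the identity of \<open>\<eta>\<close>, is equivariant under the stabilizer.

  Integrating that functional along \<open>N\<close> would give an \<open>(N, \<psi>)\<close>-equivariant functional on the functions
  supported in the open orbit, but the integral need not converge on all of the induced space \<open>V\<close>.
  What replaces it is the exactness of twisted coinvariants, in this concrete form: \<open>N\<close> is a union of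
  compact subgroups, so an element of \<open>V(N, \<psi>)\<close> is killed by averaging against \<open>\<psi>\<^sup>-\<^sup>1\<close> over every
  sufficiently large compact subgroup (\<open>jacquet_relations_average_0\<close>).  By smoothness these averages are
  finite sums over cosets, and no measure is involved.  On the other side, take the induced function that
  is supported on \<open>P K\<close>, for a small congruence subgroup \<open>K\<close>, with value \<open>v \<otimes> w\<close> at \<open>1\<close>
  (\<open>bump\<close>), and translate it to \<open>P g\<close>.  Where it does not vanish on \<open>g N\<close>, the functional takes the
  value \<open>\<psi>\<close> times a constant, so its averages are positive multiples of a nonzero vector
  (\<open>twisted_jacquet_nonzero_from_orbit\<close>).

  In both orders of the factors \<open>g\<close> is a permutation matrix and the decomposition of \<open>g u g\<^sup>-\<^sup>1\<close> along
  \<open>P\<close> and the opposite unipotent radical is explicit.  Finite fields are covered by the same argument,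
  their balls being finite.\<close>

section \<open>Ultrametric fields\<close>

locale ultrametric_field =
  fixes av :: "'f::field \<Rightarrow> real"
  assumes av_nonneg [simp]: "0 \<le> av x"
    and av_eq_0_iff [simp]: "av x = 0 \<longleftrightarrow> x = 0"
    and av_mult: "av (x * y) = av x * av y"
    and av_add: "av (x + y) \<le> max (av x) (av y)"
begin

lemma av_0 [simp]: "av 0 = 0"
  by simp

lemma av_1 [simp]: "av 1 = 1"
  using av_mult[of 1 1] by (metis av_eq_0_iff mult_cancel_left1 one_neq_zero mult_1)

lemma av_minus [simp]: "av (- x) = av x"
proof -
  have "av (-1) * av (-1) = 1"
    using av_mult[of "-1" "-1"] by simp
  moreover have "0 \<le> av (-1)" by (rule av_nonneg)
  ultimately have "av (-1) = 1"
    by (smt (verit) mult_le_cancel_left1 mult_less_cancel_left1 mult_cancel_left1)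
  then show ?thesis
    using av_mult[of "-1" x] by simp
qed

lemma av_diff_commute: "av (x - y) = av (y - x)"
  using av_minus[of "x - y"] by simp

lemma av_add_le: "av x \<le> r \<Longrightarrow> av y \<le> r \<Longrightarrow> av (x + y) \<le> r"
  using av_add[of x y] by linarith

lemma av_diff_le: "av x \<le> r \<Longrightarrow> av y \<le> r \<Longrightarrow> av (x - y) \<le> r"
  using av_add_le[of x r "- y"] by simp

lemma av_sum_le:
  assumes "0 \<le> r" "\<And>i. i \<in> I \<Longrightarrow> av (f i) \<le> r"
  shows "av (sum f I) \<le> r"
  using assms(2) by (induction I rule: infinite_finite_induct) (simp_all add: assms(1) av_add_le)

lemma av_power: "av (x ^ k) = av x ^ k"
  by (induction k) (simp_all add: av_mult)

lemma av_inverse: "av (inverse x) = inverse (av x)"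
proof (cases "x = 0")
  case False
  then have "av (inverse x) * av x = 1"
    by (simp flip: av_mult)
  then show ?thesis
    by (metis inverse_unique mult.commute)
qed simp

lemma Metric_space_av: "Metric_space UNIV (\<lambda>x y. av (x - y))"
proof
  fix x y z :: 'f
  have "av (x - z) \<le> max (av (x - y)) (av (y - z))"
    using av_add[of "x - y" "y - z"] by simp
  then show "av (x - z) \<le> av (x - y) + av (y - z)"
    using av_nonneg[of "x - y"] av_nonneg[of "y - z"] by linarith
qed (auto intro: av_diff_commute)

lemma openin_field_topology:
  "openin (field_topology av) U \<longleftrightarrow> (\<forall>x\<in>U. \<exists>r>0. \<forall>y. av (y - x) < r \<longrightarrow> y \<in> U)"
proof -
  interpret Metric_space UNIV "\<lambda>x y. av (x - y)" by (rule Metric_space_av)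
  show ?thesis
    unfolding field_topology_def openin_mtopology mball_def
    by (auto simp: subset_eq av_diff_commute)
qed

lemma topspace_field_topology [simp]: "topspace (field_topology av) = UNIV"
proof -
  interpret Metric_space UNIV "\<lambda>x y. av (x - y)" by (rule Metric_space_av)
  show ?thesis
    unfolding field_topology_def by simp
qed

text \<open>A nontrivial subgroup of the unit circle does not stay close to \<open>1\<close>: squaring moves
  points near \<open>1\<close> away from it by a factor of at least \<open>3 / 2\<close>.  As the closed balls around \<open>0\<close>
  are subgroups, continuity forces a character to be trivial on one of them.\<close>

lemma additive_character_trivial_on_ball:
  assumes "nontrivial_additive_character av \<psi>\<^sub>0"
  obtains \<epsilon> where "0 < \<epsilon>" "\<And>x. av x \<le> \<epsilon> \<Longrightarrow> \<psi>\<^sub>0 x = 1"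
proof -
  have add: "\<psi>\<^sub>0 (x + y) = \<psi>\<^sub>0 x * \<psi>\<^sub>0 y" and norm: "cmod (\<psi>\<^sub>0 x) = 1" for x y
    using assms by (auto simp: nontrivial_additive_character_def)
  have "\<psi>\<^sub>0 0 * \<psi>\<^sub>0 0 = \<psi>\<^sub>0 0" "\<psi>\<^sub>0 0 \<noteq> 0"
    using add[of 0 0] norm[of 0] by auto
  then have zero: "\<psi>\<^sub>0 0 = 1" by simp
  have "continuous_map (field_topology av) euclidean \<psi>\<^sub>0"
    using assms by (simp add: nontrivial_additive_character_def)
  then have "openin (field_topology av) {x. \<psi>\<^sub>0 x \<in> ball 1 (1/2)}"
    by (auto dest: openin_continuous_map_preimage[where U = "ball 1 (1/2)"])
  then have "\<forall>x\<in>{x. \<psi>\<^sub>0 x \<in> ball 1 (1/2)}. \<exists>r>0. \<forall>y. av (y - x) < r \<longrightarrow>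
      y \<in> {x. \<psi>\<^sub>0 x \<in> ball 1 (1/2)}"
    by (simp only: openin_field_topology)
  from this[rule_format, of 0] obtain r where r: "0 < r" "\<And>y. av y < r \<Longrightarrow> dist 1 (\<psi>\<^sub>0 y) < 1/2"
    by (auto simp: zero)
  have expand: "(3/2) * cmod (\<psi>\<^sub>0 x - 1) \<le> cmod (\<psi>\<^sub>0 (x + x) - 1)" if "av x < r" for x
  proof -
    have "cmod (\<psi>\<^sub>0 x - 1) < 1/2"
      using r(2)[OF that] by (simp add: dist_norm norm_minus_commute)
    moreover have "cmod 2 \<le> cmod (\<psi>\<^sub>0 x + 1) + cmod (\<psi>\<^sub>0 x - 1)"
      using norm_triangle_ineq4[of "\<psi>\<^sub>0 x + 1" "\<psi>\<^sub>0 x - 1"] by simp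
    ultimately have "3/2 \<le> cmod (\<psi>\<^sub>0 x + 1)"
      by simp
    moreover have "\<psi>\<^sub>0 (x + x) - 1 = (\<psi>\<^sub>0 x + 1) * (\<psi>\<^sub>0 x - 1)"
      unfolding add by (simp add: algebra_simps)
    ultimately show ?thesis
      using mult_right_mono[of "3/2" "cmod (\<psi>\<^sub>0 x + 1)" "cmod (\<psi>\<^sub>0 x - 1)"]
      by (simp only: norm_mult norm_ge_zero)
  qed
  have iter: "(3/2) ^ k * cmod (\<psi>\<^sub>0 x - 1) < 1/2" if "av x < r" for x k
    using that
  proof (induction k arbitrary: x)
    case 0
    then show ?case
      using r(2)[of x] by (simp add: dist_norm norm_minus_commute)
  next
    case (Suc k)
    have "av (x + x) < r"
      using av_add[of x x] Suc.prems by simp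
    then have "(3/2) ^ k * cmod (\<psi>\<^sub>0 (x + x) - 1) < 1/2"
      by (rule Suc.IH)
    moreover have "(3/2) ^ k * ((3/2) * cmod (\<psi>\<^sub>0 x - 1)) \<le> (3/2) ^ k * cmod (\<psi>\<^sub>0 (x + x) - 1)"
      by (intro mult_left_mono expand Suc.prems) simp
    moreover have "(3/2) ^ Suc k * cmod (\<psi>\<^sub>0 x - 1) = (3/2) ^ k * ((3/2) * cmod (\<psi>\<^sub>0 x - 1))"
      by simp
    ultimately show ?case
      by linarith
  qed
  have "\<psi>\<^sub>0 x = 1" if "av x \<le> r / 2" for x
  proof (rule ccontr)
    assume "\<psi>\<^sub>0 x \<noteq> 1"
    then have pos: "0 < cmod (\<psi>\<^sub>0 x - 1)" by simp
    obtain k where "1 / cmod (\<psi>\<^sub>0 x - 1) < (3/2) ^ k"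
      using real_arch_pow[of "3/2" "1 / cmod (\<psi>\<^sub>0 x - 1)"] by auto
    then have "1 < (3/2) ^ k * cmod (\<psi>\<^sub>0 x - 1)"
      using pos by (simp add: divide_simps)
    moreover have "av x < r"
      using that r(1) by simp
    ultimately show False
      using iter[of x k] by simp
  qed
  then show thesis
    using that[of "r/2"] r(1) by simp
qed

end

text \<open>Total boundedness of balls: the form of local compactness on which the averaging over \<open>N\<close> rests.\<close>

definition finitely_covered_balls :: "('f::field \<Rightarrow> real) \<Rightarrow> bool"
  where "finitely_covered_balls av \<longleftrightarrow>
    (\<forall>R. \<forall>\<epsilon>>0. \<exists>S. finite S \<and> (\<forall>x. av x \<le> R \<longrightarrow> (\<exists>s\<in>S. av (x - s) \<le> \<epsilon>)))"

lemma finite_field_ultrametric: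
  assumes "finite_field av"
  shows "ultrametric_field av" "finitely_covered_balls av"
proof -
  have av: "av = (\<lambda>x. if x = 0 then 0 else 1)" and fin: "finite (UNIV :: 'a set)"
    using assms by (auto simp: finite_field_def)
  show "ultrametric_field av"
    by unfold_locales (auto simp: av)
  show "finitely_covered_balls av"
    unfolding finitely_covered_balls_def
    by (intro allI impI exI[of _ UNIV] conjI fin) (auto simp: av intro: bexI[of _ x for x])
qed

lemma nonarch_local_field_ultrametric:
  assumes "nonarch_local_field av"
  shows "ultrametric_field av"
  using assms by unfold_locales (auto simp: nonarch_local_field_def)

text \<open>The ring of integers is covered by finitely many residue classes, each of which is a
  translate of \<open>\<pi>\<close> times the ring of integers, where \<open>\<pi>\<close> is a uniformizer.  Iterating this covers
  it by finitely many balls of radius \<open>q\<^sup>-\<^sup>k\<close>, and multiplying by a power of \<open>\<pi>\<close> carries the cover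
  to any other ball.\<close>

lemma nonarch_local_field_finitely_covered:
  assumes "nonarch_local_field av"
  shows "finitely_covered_balls av"
proof -
  interpret ultrametric_field av
    using assms by (rule nonarch_local_field_ultrametric)
  define q where "q = real (card (residue_field av))"
  define E where "E = {(x, y). av x \<le> 1 \<and> av y \<le> 1 \<and> av (x - y) < 1}"
  have fin: "finite (residue_field av)"
    and val_group: "av ` (UNIV - {0}) = range (\<lambda>k::int. q powi k)"
    using assms by (auto simp: nonarch_local_field_def q_def)
  have res: "residue_field av = {x. av x \<le> 1} // E"
    by (simp add: residue_field_def E_def)
  have "E `` {0} \<in> residue_field av" "E `` {1} \<in> residue_field av"
    unfolding res by (rule quotientI, simp)+
  moreover have "E `` {0} \<noteq> E `` {1}"
  proof -
    have "1 \<in> E `` {1}" "1 \<notin> E `` {0}"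
      by (simp_all add: E_def)
    then show ?thesis by metis
  qed
  ultimately have "card {E `` {0}, E `` {1}} = 2" "{E `` {0}, E `` {1}} \<subseteq> residue_field av"
    by simp_all
  with card_mono[OF fin this(2)] have q: "q \<ge> 2"
    by (simp add: q_def)
  have "inverse q \<in> range (\<lambda>k::int. q powi k)"
    by (rule range_eqI[of _ _ "-1"]) (simp add: power_int_minus)
  then have "inverse q \<in> av ` (UNIV - {0})"
    by (simp only: val_group)
  then obtain \<pi> where "inverse q = av \<pi>"
    by (rule imageE)
  then have \<pi>: "av \<pi> = inverse q"
    by (rule sym)
  with q have \<pi>0: "\<pi> \<noteq> 0" by auto
  \<comment> \<open>The value group is discrete, so the open unit ball is the closed ball of radius \<open>1 / q\<close>.\<close>
  have gap: "av x \<le> inverse q" if "av x < 1" for x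
  proof (cases "x = 0")
    case False
    then have "av x \<in> av ` (UNIV - {0})"
      by blast
    then have "av x \<in> range (\<lambda>k::int. q powi k)"
      by (simp only: val_group)
    then obtain k :: int where k: "av x = q powi k" by auto
    have "\<not> 0 \<le> k"
    proof
      assume "0 \<le> k"
      then have "q powi 0 \<le> q powi k"
        using q by (intro power_int_increasing) auto
      then show False
        using that k by simp
    qed
    then have "q powi k \<le> q powi (-1)"
      using q by (intro power_int_increasing) auto
    then show ?thesis
      by (simp add: k power_int_minus)
  qed (use q in simp)
  define S0 where "S0 = (\<lambda>C. SOME x. x \<in> C) ` residue_field av"
  have S0: "\<exists>s\<in>S0. av (x - s) \<le> inverse q" if "av x \<le> 1" for x
  proof -
    have C: "E `` {x} \<in> residue_field av"
      using that by (auto simp: res quotient_def)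
    have "x \<in> E `` {x}"
      using that by (auto simp: E_def)
    define s where "s = (SOME y. y \<in> E `` {x})"
    have "s \<in> E `` {x}"
      unfolding s_def using \<open>x \<in> E `` {x}\<close> by (rule someI)
    then have "av (x - s) < 1"
      by (simp add: E_def)
    moreover have "s \<in> S0"
      unfolding S0_def s_def using C by (rule imageI)
    ultimately show ?thesis
      using gap by blast
  qed
  have unit_ball: "\<exists>S. finite S \<and> (\<forall>x. av x \<le> 1 \<longrightarrow> (\<exists>s\<in>S. av (x - s) \<le> inverse q ^ k))" for k
  proof (induction k)
    case 0
    show ?case by (rule exI[of _ "{0}"]) simp
  next
    case (Suc k)
    then obtain S where S: "finite S" "\<And>x. av x \<le> 1 \<Longrightarrow> \<exists>s\<in>S. av (x - s) \<le> inverse q ^ k"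
      by blast
    show ?case
    proof (intro exI[of _ "(\<lambda>(s0, s). s0 + \<pi> * s) ` (S0 \<times> S)"] conjI allI impI)
      show "finite ((\<lambda>(s0, s). s0 + \<pi> * s) ` (S0 \<times> S))"
        using S(1) fin by (simp add: S0_def)
      fix x assume "av x \<le> 1"
      then obtain s0 where s0: "s0 \<in> S0" "av (x - s0) \<le> inverse q"
        using S0 by blast
      define y where "y = (x - s0) / \<pi>"
      have "av y = av (x - s0) * q"
        by (simp add: y_def divide_inverse av_mult av_inverse \<pi>)
      also have "\<dots> \<le> 1"
        using s0(2) q by (simp add: field_simps)
      finally obtain s where s: "s \<in> S" "av (y - s) \<le> inverse q ^ k"
        using S(2) by blast
      have "\<pi> * y = x - s0"
        using \<pi>0 by (simp add: y_def)
      then have "x - (s0 + \<pi> * s) = \<pi> * (y - s)"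
        by (simp add: right_diff_distrib)
      then have "av (x - (s0 + \<pi> * s)) \<le> inverse q ^ Suc k"
        using s(2) q by (simp add: av_mult \<pi> mult_left_mono)
      then show "\<exists>s\<in>(\<lambda>(s0, s). s0 + \<pi> * s) ` (S0 \<times> S). av (x - s) \<le> inverse q ^ Suc k"
        using s0(1) s(1) by force
    qed
  qed
  show ?thesis
    unfolding finitely_covered_balls_def
  proof (intro allI impI)
    fix R \<epsilon> :: real assume \<epsilon>: "0 < \<epsilon>"
    obtain m where m: "R < q ^ m"
      using real_arch_pow[of q R] q by auto
    obtain k where k: "q ^ m / \<epsilon> < q ^ k"
      using real_arch_pow[of q "q ^ m / \<epsilon>"] q by auto
    obtain S where S: "finite S" "\<And>x. av x \<le> 1 \<Longrightarrow> \<exists>s\<in>S. av (x - s) \<le> inverse q ^ k"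
      using unit_ball by blast
    show "\<exists>S. finite S \<and> (\<forall>x. av x \<le> R \<longrightarrow> (\<exists>s\<in>S. av (x - s) \<le> \<epsilon>))"
    proof (intro exI[of _ "(\<lambda>s. s / \<pi> ^ m) ` S"] conjI allI impI)
      show "finite ((\<lambda>s. s / \<pi> ^ m) ` S)" using S(1) by simp
      fix x assume "av x \<le> R"
      then have "av (x * \<pi> ^ m) \<le> 1"
        using m q by (simp add: av_mult av_power \<pi> power_inverse field_simps)
      then obtain s where s: "s \<in> S" "av (x * \<pi> ^ m - s) \<le> inverse q ^ k"
        using S(2) by blast
      have "x - s / \<pi> ^ m = (x * \<pi> ^ m - s) / \<pi> ^ m"
        using \<pi>0 by (simp add: diff_divide_distrib)
      then have "av (x - s / \<pi> ^ m) = av (x * \<pi> ^ m - s) * q ^ m"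
        by (simp add: divide_inverse av_mult av_inverse av_power \<pi> power_inverse)
      also have "\<dots> \<le> inverse q ^ k * q ^ m"
        using s(2) q by (intro mult_right_mono) auto
      also have "\<dots> \<le> \<epsilon>"
        using k \<epsilon> q by (simp add: field_simps power_inverse)
      finally show "\<exists>s\<in>(\<lambda>s. s / \<pi> ^ m) ` S. av (x - s) \<le> \<epsilon>"
        using s(1) by blast
    qed
  qed
qed

section \<open>General linear groups over an ultrametric field\<close>

lemma GL_carrier: "g \<in> GL m \<Longrightarrow> g \<in> carrier_mat m m"
  by (simp add: GL_def)

lemma GL_I:
  fixes g h :: "'f::field mat"
  assumes "g \<in> carrier_mat m m" "h \<in> carrier_mat m m" "g * h = 1\<^sub>m m"
  shows "g \<in> GL m"
proof -
  have "h * g = 1\<^sub>m m"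
    by (rule mat_mult_left_right_inverse[OF assms])
  then show ?thesis
    using assms by (auto simp: GL_def invertible_mat_def inverts_mat_def intro!: exI[of _ h])
qed

lemma GL_inverse:
  fixes g :: "'f::field mat"
  assumes "g \<in> GL m"
  obtains h where "h \<in> GL m" "g * h = 1\<^sub>m m" "h * g = 1\<^sub>m m"
proof -
  obtain h where g: "g \<in> carrier_mat m m" and gh: "g * h = 1\<^sub>m m" and hg: "h * g = 1\<^sub>m (dim_row h)"
    using assms by (auto simp: GL_def invertible_mat_def inverts_mat_def)
  have "dim_col (h * g) = m" "dim_col (g * h) = dim_col h"
    using g by auto
  with gh hg have h: "h \<in> carrier_mat m m"
    by (metis carrier_matI index_one_mat(2,3))
  then have "h * g = 1\<^sub>m m"
    using hg by simp
  then show thesis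
    using that gh GL_I[OF h g] by blast
qed

lemma one_in_GL [simp]: "1\<^sub>m m \<in> (GL m :: 'f::field mat set)"
  by (rule GL_I[of _ _ "1\<^sub>m m"]) simp_all

lemma mult_in_GL:
  fixes g h :: "'f::field mat"
  assumes "g \<in> GL m" "h \<in> GL m"
  shows "g * h \<in> GL m"
proof -
  obtain g' h' where g': "g' \<in> GL m" "g * g' = 1\<^sub>m m" and h': "h' \<in> GL m" "h * h' = 1\<^sub>m m"
    using assms by (meson GL_inverse)
  note c = GL_carrier[OF assms(1)] GL_carrier[OF assms(2)] GL_carrier[OF g'(1)] GL_carrier[OF h'(1)]
  have "(g * h) * (h' * g') = g * ((h * h') * g')"
    using c by (simp add: assoc_mult_mat[of _ m m _ m _ m])
  also have "\<dots> = 1\<^sub>m m"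
    using c g' h' by simp
  finally show ?thesis
    using c by (intro GL_I[of _ _ "h' * g'"]) auto
qed

lemma det_nonzero_in_GL:
  fixes g :: "'f::field mat"
  assumes "g \<in> carrier_mat m m" "det g \<noteq> 0"
  shows "g \<in> GL m"
proof -
  have "g \<in> Units (ring_mat TYPE('f) m ())"
    by (rule det_non_zero_imp_unit[OF assms])
  then obtain h where "h \<in> carrier_mat m m" "g * h = 1\<^sub>m m"
    by (auto simp: Units_def ring_mat_def)
  then show ?thesis
    using assms(1) by (intro GL_I)
qed

context ultrametric_field
begin

definition mat_bounded :: "real \<Rightarrow> 'f mat \<Rightarrow> bool"
  where "mat_bounded r M \<longleftrightarrow> (\<forall>i<dim_row M. \<forall>j<dim_col M. av (M $$ (i, j)) \<le> r)"

lemma mat_bounded_mono: "mat_bounded r M \<Longrightarrow> r \<le> s \<Longrightarrow> mat_bounded s M"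
  unfolding mat_bounded_def by force

lemma mat_bounded_zero [simp]: "0 \<le> r \<Longrightarrow> mat_bounded r (0\<^sub>m a b)"
  by (simp add: mat_bounded_def)

lemma mat_bounded_add:
  assumes "A \<in> carrier_mat a b" "B \<in> carrier_mat a b" "mat_bounded r A" "mat_bounded r B"
  shows "mat_bounded r (A + B)"
  using assms by (auto simp: mat_bounded_def av_add_le)

lemma mat_bounded_minus:
  assumes "A \<in> carrier_mat a b" "B \<in> carrier_mat a b" "mat_bounded r A" "mat_bounded r B"
  shows "mat_bounded r (A - B)"
  using assms by (auto simp: mat_bounded_def av_diff_le)

lemma mat_bounded_uminus: "mat_bounded r A \<Longrightarrow> mat_bounded r (- A)"
  by (simp add: mat_bounded_def)

lemma mat_bounded_mult:
  assumes "A \<in> carrier_mat a b" "B \<in> carrier_mat b c" "mat_bounded r A" "mat_bounded s B"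
    and "0 \<le> r" "0 \<le> s"
  shows "mat_bounded (r * s) (A * B)"
  unfolding mat_bounded_def
proof (intro allI impI)
  fix i j assume "i < dim_row (A * B)" "j < dim_col (A * B)"
  then have ij: "i < a" "j < c" using assms by auto
  have "av (A $$ (i, l) * B $$ (l, j)) \<le> r * s" if "l < b" for l
    unfolding av_mult using assms ij that by (intro mult_mono) (auto simp: mat_bounded_def)
  then have "av (\<Sum>l = 0..<b. A $$ (i, l) * B $$ (l, j)) \<le> r * s"
    using assms by (intro av_sum_le) auto
  moreover have "(A * B) $$ (i, j) = (\<Sum>l = 0..<b. A $$ (i, l) * B $$ (l, j))"
    using assms ij by (simp add: scalar_prod_def)
  ultimately show "av ((A * B) $$ (i, j)) \<le> r * s"
    by simp
qed

lemma mat_bounded_exists: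
  obtains r where "0 < r" "mat_bounded r M"
proof -
  define E where "E = (\<lambda>ij. av (M $$ ij)) ` ({..<dim_row M} \<times> {..<dim_col M})"
  have "finite E" by (simp add: E_def)
  then have "\<forall>i<dim_row M. \<forall>j<dim_col M. av (M $$ (i, j)) \<le> Max (insert 1 E)"
    by (auto simp: E_def intro!: Max_ge)
  moreover have "1 \<le> Max (insert 1 E)"
    using \<open>finite E\<close> by (intro Max_ge) auto
  ultimately show thesis
    using that[of "Max (insert 1 E)"] by (auto simp: mat_bounded_def)
qed

text \<open>An ultrametric contraction argument: a largest entry of \<open>X\<close> cannot come from \<open>M X\<close>, so it
  comes from \<open>A\<close>.\<close>

lemma mat_bounded_fixpoint:
  assumes X: "X \<in> carrier_mat a b" and M: "M \<in> carrier_mat a a" and A: "A \<in> carrier_mat a b"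
    and eq: "X = A + M * X" and bounds: "mat_bounded s A" "mat_bounded \<epsilon> M"
    and "0 \<le> s" "0 \<le> \<epsilon>" "\<epsilon> < 1"
  shows "mat_bounded s X"
proof (cases "a = 0 \<or> b = 0")
  case True
  then show ?thesis
    using X by (auto simp: mat_bounded_def)
next
  case False
  define E where "E = (\<lambda>ij. av (X $$ ij)) ` ({..<a} \<times> {..<b})"
  have E: "finite E" "E \<noteq> {}"
    using False by (auto simp: E_def)
  have XE: "mat_bounded (Max E) X"
    using X E(1) by (auto simp: mat_bounded_def E_def intro!: Max_ge)
  obtain i j where ij: "i < a" "j < b" "av (X $$ (i, j)) = Max E"
    using Max_in[OF E] by (auto simp: E_def)
  then have pos: "0 \<le> Max E"
    using av_nonneg[of "X $$ (i, j)"] by linarith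
  have "av ((M * X) $$ (i, j)) \<le> \<epsilon> * Max E"
    using mat_bounded_mult[OF M X bounds(2) XE] pos assms ij by (simp add: mat_bounded_def)
  moreover have "av (A $$ (i, j)) \<le> s"
    using bounds(1) A ij by (simp add: mat_bounded_def)
  moreover have "X $$ (i, j) = A $$ (i, j) + (M * X) $$ (i, j)"
    using arg_cong[OF eq, of "\<lambda>Z. Z $$ (i, j)"] ij X M A by simp
  ultimately have "Max E \<le> max s (\<epsilon> * Max E)"
    using av_add[of "A $$ (i, j)" "(M * X) $$ (i, j)"] ij(3) by auto
  moreover have "\<epsilon> * Max E < Max E" if "s < Max E"
    using that assms pos by simp
  ultimately have "Max E \<le> s"
    by linarith
  then show ?thesis
    using XE mat_bounded_mono by blast
qed

text \<open>The congruence subgroups of \<open>GL m\<close>, for \<open>\<epsilon> < 1\<close>: a basis of neighbourhoods of \<open>1\<close>.\<close>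

definition congruence_subgroup :: "nat \<Rightarrow> real \<Rightarrow> 'f mat set"
  where "congruence_subgroup m \<epsilon> = {k \<in> carrier_mat m m. mat_bounded \<epsilon> (k - 1\<^sub>m m)}"

lemma congruence_subgroup_mono:
  "\<epsilon> \<le> \<epsilon>' \<Longrightarrow> congruence_subgroup m \<epsilon> \<subseteq> congruence_subgroup m \<epsilon>'"
  by (auto simp: congruence_subgroup_def intro: mat_bounded_mono)

lemma congruence_subgroup_bounded:
  assumes "k \<in> congruence_subgroup m \<epsilon>" "\<epsilon> \<le> 1"
  shows "mat_bounded 1 k"
proof -
  have k: "k \<in> carrier_mat m m" "mat_bounded 1 (k - 1\<^sub>m m)"
    using assms by (auto simp: congruence_subgroup_def intro: mat_bounded_mono)
  have "k = (k - 1\<^sub>m m) + 1\<^sub>m m"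
    using k(1) by (intro eq_matI) auto
  moreover have "mat_bounded 1 ((k - 1\<^sub>m m) + 1\<^sub>m m)"
    using k by (intro mat_bounded_add[of _ m m]) (auto simp: mat_bounded_def)
  ultimately show ?thesis by simp
qed

lemma congruence_subgroup_mult:
  assumes k: "k \<in> congruence_subgroup m \<epsilon>" and l: "l \<in> congruence_subgroup m \<epsilon>"
    and "0 \<le> \<epsilon>" "\<epsilon> \<le> 1"
  shows "k * l \<in> congruence_subgroup m \<epsilon>"
proof -
  have c: "k \<in> carrier_mat m m" "l \<in> carrier_mat m m"
    and b: "mat_bounded \<epsilon> (k - 1\<^sub>m m)" "mat_bounded \<epsilon> (l - 1\<^sub>m m)"
    using k l by (auto simp: congruence_subgroup_def)
  have "k * l - 1\<^sub>m m = k * (l - 1\<^sub>m m) + (k - 1\<^sub>m m)"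
    using c by (subst mult_minus_distrib_mat[of _ m m]) (auto intro!: eq_matI)
  moreover have "mat_bounded (1 * \<epsilon>) (k * (l - 1\<^sub>m m))"
    using c b assms by (intro mat_bounded_mult[of _ m m _ m] congruence_subgroup_bounded[OF k]) auto
  then have "mat_bounded \<epsilon> (k * (l - 1\<^sub>m m) + (k - 1\<^sub>m m))"
    using c b by (intro mat_bounded_add[of _ m m]) (auto intro!: mult_carrier_mat minus_carrier_mat)
  ultimately have "mat_bounded \<epsilon> (k * l - 1\<^sub>m m)"
    by (simp only:)
  then show ?thesis
    using c by (simp add: congruence_subgroup_def)
qed

text \<open>A vector in the kernel of \<open>k\<close>, as well as an inverse of \<open>k\<close>, solves a contraction equation
  \<open>X = A + (1 - k) X\<close>.\<close>

lemma congruence_subgroup_in_GL: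
  assumes k: "k \<in> congruence_subgroup m \<epsilon>" and \<epsilon>: "0 \<le> \<epsilon>" "\<epsilon> < 1"
  shows "k \<in> GL m"
proof -
  have c: "k \<in> carrier_mat m m" and b: "mat_bounded \<epsilon> (k - 1\<^sub>m m)"
    using k by (auto simp: congruence_subgroup_def)
  have "det k \<noteq> 0"
  proof
    assume "det k = 0"
    then obtain v where v: "v \<in> carrier_vec m" "v \<noteq> 0\<^sub>v m" "k *\<^sub>v v = 0\<^sub>v m"
      using det_0_iff_vec_prod_zero_field[OF c] by blast
    define X where "X = Matrix.mat m 1 (\<lambda>(i, j). vec_index v i)"
    have X: "X \<in> carrier_mat m 1" by (simp add: X_def)
    have "col X 0 = v"
      using v(1) by (intro eq_vecI) (auto simp: X_def)
    then have "k * X = 0\<^sub>m m 1"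
    proof (intro eq_matI)
      fix i j assume "i < dim_row (0\<^sub>m m 1 :: 'f mat)" "j < dim_col (0\<^sub>m m 1 :: 'f mat)"
      then have ij: "i < m" "j = 0" by auto
      have "vec_index (k *\<^sub>v v) i = 0" using v(3) ij by simp
      then show "(k * X) $$ (i, j) = 0\<^sub>m m 1 $$ (i, j)"
        using \<open>col X 0 = v\<close> ij c X by simp
    qed (use c X in auto)
    then have "(k - 1\<^sub>m m) * X = - X"
      using c X by (simp add: minus_mult_distrib_mat[of _ m m] minus_carrier_mat) (auto intro!: eq_matI)
    then have "X = 0\<^sub>m m 1 + (- (k - 1\<^sub>m m)) * X"
      using c X by (auto intro!: eq_matI simp: minus_carrier_mat)
    then have "mat_bounded 0 X"
      using X c b \<epsilon> by (intro mat_bounded_fixpoint[of X m 1 "- (k - 1\<^sub>m m)" "0\<^sub>m m 1" 0 \<epsilon>]) (simp_all add: mat_bounded_uminus minus_carrier_mat)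
    then have "av (vec_index v i) \<le> 0" if "i < m" for i
      using that by (auto simp: mat_bounded_def X_def)
    then have "vec_index v i = 0" if "i < m" for i
      using that by (metis antisym av_nonneg av_eq_0_iff)
    then have "v = 0\<^sub>v m"
      using v(1) by (intro eq_vecI) auto
    with v(2) show False by simp
  qed
  then show ?thesis
    using c by (rule det_nonzero_in_GL[rotated])
qed

lemma congruence_subgroup_inverse:
  assumes k: "k \<in> congruence_subgroup m \<epsilon>" and \<epsilon>: "0 \<le> \<epsilon>" "\<epsilon> < 1"
  obtains k' where "k' \<in> congruence_subgroup m \<epsilon>" "k * k' = 1\<^sub>m m" "k' * k = 1\<^sub>m m"
proof -
  have c: "k \<in> carrier_mat m m" and b: "mat_bounded \<epsilon> (k - 1\<^sub>m m)"
    using k by (auto simp: congruence_subgroup_def)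
  obtain k' where k': "k' \<in> GL m" and inv: "k * k' = 1\<^sub>m m" "k' * k = 1\<^sub>m m"
    using GL_inverse[OF congruence_subgroup_in_GL[OF assms]] .
  note c' = GL_carrier[OF k']
  have "(k - 1\<^sub>m m) * k' = 1\<^sub>m m - k'"
    using c c' inv by (simp add: minus_mult_distrib_mat[of _ m m])
  then have eq: "(- (k - 1\<^sub>m m)) * k' = k' - 1\<^sub>m m"
    using c c' by (auto intro!: eq_matI)
  then have "k' = 1\<^sub>m m + (- (k - 1\<^sub>m m)) * k'"
    using c' by (auto intro!: eq_matI)
  moreover have "mat_bounded 1 (1\<^sub>m m)"
    by (simp add: mat_bounded_def)
  ultimately have "mat_bounded 1 k'"
    using c c' b \<epsilon> by (intro mat_bounded_fixpoint[of k' m m "- (k - 1\<^sub>m m)" "1\<^sub>m m" 1 \<epsilon>])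
      (simp_all add: mat_bounded_uminus minus_carrier_mat)
  then have "mat_bounded (\<epsilon> * 1) ((- (k - 1\<^sub>m m)) * k')"
    using c c' b \<epsilon> by (intro mat_bounded_mult[of _ m m _ m] mat_bounded_uminus) auto
  then have "k' \<in> congruence_subgroup m \<epsilon>"
    using c' by (simp add: congruence_subgroup_def eq)
  then show thesis
    using that inv by blast
qed

lemma av_det_le_1:
  assumes c: "k \<in> carrier_mat m m" and b: "mat_bounded 1 k"
  shows "av (det k) \<le> 1"
proof -
  have "av (signof p * (\<Prod>i = 0..<m. k $$ (i, p i))) \<le> 1" if p: "p permutes {0..<m}" for p
  proof -
    have "av (\<Prod>i\<in>I. k $$ (i, p i)) \<le> 1" if "I \<subseteq> {0..<m}" for I
    proof -
      have "finite I" using that finite_subset by blast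
      then show ?thesis using that
      proof (induction I)
        case (insert i I)
        then have "av (k $$ (i, p i)) \<le> 1"
          using b c permutes_in_image[OF p, of i] by (auto simp: mat_bounded_def)
        with insert show ?case
          by (simp add: av_mult mult_le_one)
      qed simp
    qed
    moreover have "av (signof p) = 1"
      by (simp add: sign_def)
    ultimately show ?thesis
      by (simp add: av_mult)
  qed
  then show ?thesis
    unfolding det_def'[OF c] by (intro av_sum_le) auto
qed

text \<open>Both \<open>k\<close> and its inverse have an integral determinant.\<close>

lemma av_det_congruence_subgroup:
  assumes k: "k \<in> congruence_subgroup m \<epsilon>" and \<epsilon>: "0 \<le> \<epsilon>" "\<epsilon> < 1"
  shows "av (det k) = 1"
proof -
  obtain k' where k': "k' \<in> congruence_subgroup m \<epsilon>" and inv: "k * k' = 1\<^sub>m m"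
    using congruence_subgroup_inverse[OF assms] .
  have c: "k \<in> carrier_mat m m" "k' \<in> carrier_mat m m"
    using k k' by (auto simp: congruence_subgroup_def)
  have "av (det k) \<le> 1" "av (det k') \<le> 1"
    using av_det_le_1 c congruence_subgroup_bounded k k' \<epsilon> by (meson less_imp_le)+
  moreover have "av (det k) * av (det k') = 1"
    using c inv by (simp flip: av_mult det_mult)
  ultimately show ?thesis
    by (metis av_nonneg antisym mult_left_le)
qed

lemma openin_GL_topology:
  "openin (GL_topology av m) S \<longleftrightarrow>
    S \<subseteq> GL m \<and> (\<forall>g\<in>S. \<exists>\<delta>>0. \<forall>y\<in>GL m. mat_bounded \<delta> (y - g) \<longrightarrow> y \<in> S)"
  (is "_ \<longleftrightarrow> _ \<and> ?nbhd")
proof (intro iffI conjI)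
  let ?I = "{..<m} \<times> {..<m}"
  let ?\<iota> = "\<lambda>g :: 'f mat. restrict (\<lambda>ij. g $$ ij) ?I"
  let ?T = "product_topology (\<lambda>_. field_topology av) ?I"
  {
    assume "openin (GL_topology av m) S"
    then obtain U where U: "openin ?T U" "S = ?\<iota> -` U \<inter> GL m"
      by (auto simp: GL_topology_def openin_pullback_topology)
    then show "S \<subseteq> GL m" by simp
    show ?nbhd
    proof
      fix g assume g: "g \<in> S"
      with U(2) have "?\<iota> g \<in> U" by simp
      from U(1)[unfolded openin_product_topology_alt, rule_format, OF this]
      obtain B where B: "\<forall>ij\<in>?I. openin (field_topology av) (B ij)"
          "?\<iota> g \<in> Pi\<^sub>E ?I B" "Pi\<^sub>E ?I B \<subseteq> U"
        by (elim exE conjE) (rule that)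
      have "\<forall>ij\<in>?I. \<exists>r>0. \<forall>y. av (y - g $$ ij) < r \<longrightarrow> y \<in> B ij"
      proof
        fix ij assume ij: "ij \<in> ?I"
        then have "g $$ ij \<in> B ij"
          using PiE_mem[OF B(2) ij] by simp
        then show "\<exists>r>0. \<forall>y. av (y - g $$ ij) < r \<longrightarrow> y \<in> B ij"
          using bspec[OF B(1) ij] unfolding openin_field_topology by blast
      qed
      then obtain r where r: "\<And>ij. ij \<in> ?I \<Longrightarrow> 0 < r ij"
          "\<And>ij y. ij \<in> ?I \<Longrightarrow> av (y - g $$ ij) < r ij \<Longrightarrow> y \<in> B ij"
        by metis
      define \<delta> where "\<delta> = Min (insert 1 (r ` ?I)) / 2"
      have "0 < Min (insert 1 (r ` ?I))"
        using r(1) by (subst Min_gr_iff) auto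
      then have \<delta>: "0 < \<delta>" "\<delta> < Min (insert 1 (r ` ?I))"
        by (auto simp: \<delta>_def)
      have "y \<in> S" if y: "y \<in> GL m" "mat_bounded \<delta> (y - g)" for y
      proof -
        have c: "g \<in> carrier_mat m m"
          using g U(2) by (simp add: GL_carrier)
        have "?\<iota> y ij \<in> B ij" if ij: "ij \<in> ?I" for ij
        proof -
          have "av (y $$ ij - g $$ ij) \<le> \<delta>"
            using y(2) c ij GL_carrier[OF y(1)] by (auto simp: mat_bounded_def)
          moreover have "Min (insert 1 (r ` ?I)) \<le> r ij"
            using ij by (intro Min_le) auto
          ultimately have "y $$ ij \<in> B ij"
            using \<delta>(2) by (intro r(2)[OF ij]) linarith
          then show ?thesis
            using ij by simp
        qed
        then have "?\<iota> y \<in> Pi\<^sub>E ?I B"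
          by (intro PiE_I) auto
        then show ?thesis
          using B(3) U(2) y(1) by blast
      qed
      then show "\<exists>\<delta>>0. \<forall>y\<in>GL m. mat_bounded \<delta> (y - g) \<longrightarrow> y \<in> S"
        using \<delta>(1) by blast
    qed
  }
  assume S: "S \<subseteq> GL m \<and> ?nbhd"
  then obtain \<delta> where \<delta>: "\<And>g. g \<in> S \<Longrightarrow> 0 < \<delta> g"
      "\<And>g y. g \<in> S \<Longrightarrow> y \<in> GL m \<Longrightarrow> mat_bounded (\<delta> g) (y - g) \<Longrightarrow> y \<in> S"
    by metis
  define Bx where "Bx g = Pi\<^sub>E ?I (\<lambda>ij. {x. av (x - g $$ ij) < \<delta> g})" for g
  have ball: "openin (field_topology av) {x. av (x - a) < r}" for a r
    unfolding openin_field_topology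
  proof
    fix x assume x: "x \<in> {x. av (x - a) < r}"
    have "av (y - a) < r" if "av (y - x) < r - av (x - a)" "av (y - x) < r" for y
      using av_add[of "y - x" "x - a"] that x by simp
    then show "\<exists>e>0. \<forall>y. av (y - x) < e \<longrightarrow> y \<in> {x. av (x - a) < r}"
      using x av_nonneg[of "x - a"] by (intro exI[of _ "r - av (x - a)"]) fastforce
  qed
  have "openin ?T (Bx g)" for g
    unfolding Bx_def by (rule openin_PiE[THEN iffD2]) (auto intro: ball)
  then have "openin ?T (\<Union>g\<in>S. Bx g)"
    by (intro openin_Union) auto
  moreover have "S = ?\<iota> -` (\<Union>g\<in>S. Bx g) \<inter> GL m"
  proof (intro equalityI subsetI IntI)
    fix y assume "y \<in> S"
    then show "y \<in> ?\<iota> -` (\<Union>g\<in>S. Bx g)" "y \<in> GL m"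
      using \<delta>(1) S by (auto simp: Bx_def intro!: bexI[of _ y])
  next
    fix y assume "y \<in> ?\<iota> -` (\<Union>g\<in>S. Bx g) \<inter> GL m"
    then obtain g where g: "g \<in> S" "?\<iota> y \<in> Bx g" and y: "y \<in> GL m" by auto
    have "av (y $$ ij - g $$ ij) < \<delta> g" if "ij \<in> ?I" for ij
      using PiE_mem[OF g(2)[unfolded Bx_def] that] that by simp
    moreover have "g \<in> carrier_mat m m"
      using g(1) S by (auto intro: GL_carrier)
    ultimately have "mat_bounded (\<delta> g) (y - g)"
      using GL_carrier[OF y] by (force simp: mat_bounded_def)
    then show "y \<in> S"
      using \<delta>(2) g(1) y by blast
  qed
  ultimately show "openin (GL_topology av m) S"
    unfolding GL_topology_def openin_pullback_topology by blast
qed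

lemma smooth_vector_nbhd:
  assumes "smooth_vector av m \<pi> v" "\<pi> (1\<^sub>m m) v = v"
  obtains \<epsilon> where "0 < \<epsilon>" "\<epsilon> < 1" "\<And>k. k \<in> congruence_subgroup m \<epsilon> \<Longrightarrow> \<pi> k v = v"
proof -
  have "\<forall>g\<in>{g \<in> GL m. \<pi> g v = v}. \<exists>\<delta>>0. \<forall>y\<in>GL m. mat_bounded \<delta> (y - g) \<longrightarrow>
      y \<in> {g \<in> GL m. \<pi> g v = v}"
    using assms(1) unfolding smooth_vector_def openin_GL_topology by blast
  then obtain \<delta> where \<delta>: "0 < \<delta>" "\<And>y. y \<in> GL m \<Longrightarrow> mat_bounded \<delta> (y - 1\<^sub>m m) \<Longrightarrow> \<pi> y v = v"
    using assms(2) by fastforce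
  define \<epsilon> where "\<epsilon> = min \<delta> (1/2)"
  have "\<pi> k v = v" if "k \<in> congruence_subgroup m \<epsilon>" for k
  proof (rule \<delta>(2))
    show "k \<in> GL m"
      using that \<delta>(1) by (intro congruence_subgroup_in_GL[of _ _ \<epsilon>]) (auto simp: \<epsilon>_def)
    show "mat_bounded \<delta> (k - 1\<^sub>m m)"
      using that by (auto simp: congruence_subgroup_def \<epsilon>_def intro: mat_bounded_mono)
  qed
  then show thesis
    using that[of \<epsilon>] \<delta>(1) by (simp add: \<epsilon>_def)
qed

text \<open>The stabilizer of \<open>v\<close> contains, with \<open>g\<close>, the open set \<open>g K\<close> for a congruence subgroup \<open>K\<close>.\<close>

lemma smooth_vectorI:
  assumes hom: "\<And>g h. g \<in> GL m \<Longrightarrow> h \<in> GL m \<Longrightarrow> \<pi> (g * h) v = \<pi> g (\<pi> h v)"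
    and "0 < \<epsilon>" and fixed: "\<And>k. k \<in> GL m \<Longrightarrow> k \<in> congruence_subgroup m \<epsilon> \<Longrightarrow> \<pi> k v = v"
  shows "smooth_vector av m \<pi> v"
  unfolding smooth_vector_def openin_GL_topology
proof (intro conjI ballI)
  fix g assume "g \<in> {g \<in> GL m. \<pi> g v = v}"
  then have g: "g \<in> GL m" "\<pi> g v = v" by auto
  obtain g' where g': "g' \<in> GL m" and inv: "g * g' = 1\<^sub>m m" "g' * g = 1\<^sub>m m"
    using GL_inverse[OF g(1)] .
  obtain r where r: "0 < r" "mat_bounded r g'"
    using mat_bounded_exists .
  have "\<pi> y v = v" if y: "y \<in> GL m" "mat_bounded (\<epsilon> / r) (y - g)" for y
  proof -
    note c = GL_carrier[OF g(1)] GL_carrier[OF g'] GL_carrier[OF y(1)]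
    have "g' * y - 1\<^sub>m m = g' * (y - g)"
      using c inv by (simp add: mult_minus_distrib_mat[of _ m m _ m])
    moreover have "mat_bounded (r * (\<epsilon> / r)) (g' * (y - g))"
      using c r y(2) \<open>0 < \<epsilon>\<close> by (intro mat_bounded_mult[of _ m m _ m]) auto
    ultimately have "g' * y \<in> congruence_subgroup m \<epsilon>"
      using c r(1) by (simp add: congruence_subgroup_def)
    moreover have k: "g' * y \<in> GL m"
      using g' y(1) by (rule mult_in_GL)
    ultimately have "\<pi> (g' * y) v = v"
      by (intro fixed)
    moreover have "g * (g' * y) = (g * g') * y"
      using c by (simp add: assoc_mult_mat[of _ m m _ m _ m])
    then have "y = g * (g' * y)"
      using c inv by simp
    ultimately show ?thesis
      using hom[OF g(1) k] g(2) by metis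
  qed
  then show "\<exists>\<delta>>0. \<forall>y\<in>GL m. mat_bounded \<delta> (y - g) \<longrightarrow> y \<in> {g \<in> GL m. \<pi> g v = v}"
    using r(1) \<open>0 < \<epsilon>\<close> by (intro exI[of _ "\<epsilon> / r"]) auto
qed auto

end

section \<open>Induced functions supported near the parabolic subgroup\<close>

text \<open>The product of the block upper triangular matrix with blocks \<open>g\<^sub>1\<close>, \<open>z\<close>, \<open>g\<^sub>2\<close> and the block
  lower unitriangular matrix with block \<open>Y\<close>.\<close>

definition cell_point :: "'f::field mat \<Rightarrow> 'f mat \<Rightarrow> 'f mat \<Rightarrow> 'f mat \<Rightarrow> 'f mat"
  where "cell_point g\<^sub>1 z g\<^sub>2 Y = four_block_mat (g\<^sub>1 + z * Y) z (g\<^sub>2 * Y) g\<^sub>2"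

lemma four_block_mat_eqD:
  assumes "four_block_mat A B C D = four_block_mat A' B' C' D'"
    and "A \<in> carrier_mat a a" "B \<in> carrier_mat a b" "C \<in> carrier_mat b a" "D \<in> carrier_mat b b"
    and "A' \<in> carrier_mat a a" "B' \<in> carrier_mat a b" "C' \<in> carrier_mat b a" "D' \<in> carrier_mat b b"
  shows "A = A'" "B = B'" "C = C'" "D = D'"
proof -
  have e: "four_block_mat A B C D $$ (i, j) = four_block_mat A' B' C' D' $$ (i, j)" for i j
    using assms(1) by simp
  show "A = A'"
  proof (intro eq_matI)
    fix i j assume "i < dim_row A'" "j < dim_col A'"
    then show "A $$ (i, j) = A' $$ (i, j)"
      using assms(2-) e[of i j] by auto
  qed (use assms(2-) in auto)
  show "B = B'"
  proof (intro eq_matI)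
    fix i j assume "i < dim_row B'" "j < dim_col B'"
    then show "B $$ (i, j) = B' $$ (i, j)"
      using assms(2-) e[of i "a + j"] by auto
  qed (use assms(2-) in auto)
  show "C = C'"
  proof (intro eq_matI)
    fix i j assume "i < dim_row C'" "j < dim_col C'"
    then show "C $$ (i, j) = C' $$ (i, j)"
      using assms(2-) e[of "a + i" j] by auto
  qed (use assms(2-) in auto)
  show "D = D'"
  proof (intro eq_matI)
    fix i j assume "i < dim_row D'" "j < dim_col D'"
    then show "D $$ (i, j) = D' $$ (i, j)"
      using assms(2-) e[of "a + i" "a + j"] by auto
  qed (use assms(2-) in auto)
qed

lemma mult_four_block_upper:
  fixes g\<^sub>1 :: "'f::field mat"
  assumes "h\<^sub>1 \<in> carrier_mat a a" "w \<in> carrier_mat a b" "h\<^sub>2 \<in> carrier_mat b b"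
    and "g\<^sub>1 \<in> carrier_mat a a" "z \<in> carrier_mat a b" "g\<^sub>2 \<in> carrier_mat b b" "Y \<in> carrier_mat b a"
  shows "four_block_mat h\<^sub>1 w (0\<^sub>m b a) h\<^sub>2 * cell_point g\<^sub>1 z g\<^sub>2 Y =
    cell_point (h\<^sub>1 * g\<^sub>1) (h\<^sub>1 * z + w * g\<^sub>2) (h\<^sub>2 * g\<^sub>2) Y"
proof -
  have "h\<^sub>1 * (g\<^sub>1 + z * Y) + w * (g\<^sub>2 * Y) = h\<^sub>1 * g\<^sub>1 + (h\<^sub>1 * z + w * g\<^sub>2) * Y"
    using assms
    by (simp add: mult_add_distrib_mat[of _ a a _ a] add_mult_distrib_mat[of _ a b _ _ a]
        assoc_mult_mat[of _ a a _ b _ a] assoc_mult_mat[of _ a b _ b _ a] assoc_add_mat[of _ a a])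
  moreover have "0\<^sub>m b a * (g\<^sub>1 + z * Y) + h\<^sub>2 * (g\<^sub>2 * Y) = h\<^sub>2 * g\<^sub>2 * Y"
    using assms by (simp add: assoc_mult_mat[of _ b b _ b _ a])
  moreover have "0\<^sub>m b a * z + h\<^sub>2 * g\<^sub>2 = h\<^sub>2 * g\<^sub>2"
    using assms by simp
  ultimately show ?thesis
    unfolding cell_point_def
    using assms by (subst mult_four_block_mat[of _ a a _ b _ b _ _ a _ b]) auto
qed

lemma four_block_upper_inverse:
  fixes g\<^sub>1 :: "'f::field mat"
  assumes "g\<^sub>1 \<in> GL a" "z \<in> carrier_mat a b" "g\<^sub>2 \<in> GL b"
  obtains h\<^sub>1 w h\<^sub>2 where "h\<^sub>1 \<in> GL a" "w \<in> carrier_mat a b" "h\<^sub>2 \<in> GL b"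
    "four_block_mat g\<^sub>1 z (0\<^sub>m b a) g\<^sub>2 * four_block_mat h\<^sub>1 w (0\<^sub>m b a) h\<^sub>2 = 1\<^sub>m (a + b)"
proof -
  obtain h\<^sub>1 where h1: "h\<^sub>1 \<in> GL a" "g\<^sub>1 * h\<^sub>1 = 1\<^sub>m a"
    using GL_inverse[OF assms(1)] by blast
  obtain h\<^sub>2 where h2: "h\<^sub>2 \<in> GL b" "g\<^sub>2 * h\<^sub>2 = 1\<^sub>m b" "h\<^sub>2 * g\<^sub>2 = 1\<^sub>m b"
    using GL_inverse[OF assms(3)] by blast
  note c = GL_carrier[OF assms(1)] GL_carrier[OF assms(3)] GL_carrier[OF h1(1)] GL_carrier[OF h2(1)]
    assms(2)
  define w where "w = - (h\<^sub>1 * (z * h\<^sub>2))"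
  have w: "w \<in> carrier_mat a b" using c by (simp add: w_def)
  have "g\<^sub>1 * w = - ((g\<^sub>1 * h\<^sub>1) * (z * h\<^sub>2))"
    using c by (simp add: w_def assoc_mult_mat[of _ a a _ a _ b])
  then have "g\<^sub>1 * w + z * h\<^sub>2 = 0\<^sub>m a b"
    using c h1(2) by (simp add: uminus_l_inv_mat[of _ a b])
  then have "four_block_mat g\<^sub>1 z (0\<^sub>m b a) g\<^sub>2 * four_block_mat h\<^sub>1 w (0\<^sub>m b a) h\<^sub>2 = 1\<^sub>m (a + b)"
    using c w h1 h2 by (subst mult_four_block_mat[of _ a a _ b _ b _ _ a _ b]) auto
  then show thesis
    using that w h1(1) h2(1) by blast
qed

lemma four_block_upper_in_GL:
  fixes g\<^sub>1 :: "'f::field mat"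
  assumes "g\<^sub>1 \<in> GL a" "z \<in> carrier_mat a b" "g\<^sub>2 \<in> GL b"
  shows "four_block_mat g\<^sub>1 z (0\<^sub>m b a) g\<^sub>2 \<in> GL (a + b)"
proof -
  obtain h\<^sub>1 w h\<^sub>2 where h: "h\<^sub>1 \<in> GL a" "w \<in> carrier_mat a b" "h\<^sub>2 \<in> GL b"
      "four_block_mat g\<^sub>1 z (0\<^sub>m b a) g\<^sub>2 * four_block_mat h\<^sub>1 w (0\<^sub>m b a) h\<^sub>2 = 1\<^sub>m (a + b)"
    using four_block_upper_inverse[OF assms] .
  then show ?thesis
    using assms by (intro GL_I[of _ _ "four_block_mat h\<^sub>1 w (0\<^sub>m b a) h\<^sub>2"]) (simp_all add: GL_carrier)
qed

lemma cell_point_upper: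
  fixes g\<^sub>1 :: "'f::field mat"
  assumes "g\<^sub>1 \<in> carrier_mat a a" "z \<in> carrier_mat a b" "g\<^sub>2 \<in> carrier_mat b b" "Y \<in> carrier_mat b a"
  shows "cell_point g\<^sub>1 z g\<^sub>2 Y =
    four_block_mat g\<^sub>1 z (0\<^sub>m b a) g\<^sub>2 * cell_point (1\<^sub>m a) (0\<^sub>m a b) (1\<^sub>m b) Y"
  using assms mult_four_block_upper[of g\<^sub>1 a z b g\<^sub>2 "1\<^sub>m a" "0\<^sub>m a b" "1\<^sub>m b" Y] by simp

lemma cell_point_inject:
  fixes g\<^sub>1 :: "'f::field mat"
  assumes eq: "cell_point g\<^sub>1 z g\<^sub>2 Y = cell_point g\<^sub>1' z' g\<^sub>2' Y'"
    and "g\<^sub>1 \<in> carrier_mat a a" "z \<in> carrier_mat a b" "g\<^sub>2 \<in> GL b" "Y \<in> carrier_mat b a"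
    and "g\<^sub>1' \<in> carrier_mat a a" "z' \<in> carrier_mat a b" "g\<^sub>2' \<in> GL b" "Y' \<in> carrier_mat b a"
  shows "g\<^sub>1 = g\<^sub>1'" "z = z'" "g\<^sub>2 = g\<^sub>2'" "Y = Y'"
proof -
  note c = assms(2,3) GL_carrier[OF assms(4)] assms(5-7) GL_carrier[OF assms(8)] assms(9)
  have b: "g\<^sub>1 + z * Y = g\<^sub>1' + z' * Y'" "z = z'" "g\<^sub>2 * Y = g\<^sub>2' * Y'" "g\<^sub>2 = g\<^sub>2'"
    using four_block_mat_eqD[OF eq[unfolded cell_point_def], of a b] c by auto
  obtain h where h: "h \<in> GL b" "h * g\<^sub>2 = 1\<^sub>m b"
    using GL_inverse[OF assms(4)] by blast
  have "h * (g\<^sub>2 * Y) = h * (g\<^sub>2 * Y')"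
    using b by simp
  then show Y: "Y = Y'"
    using c h(2) GL_carrier[OF h(1)] by (simp flip: assoc_mult_mat[of _ b b _ b _ a])
  show "z = z'" "g\<^sub>2 = g\<^sub>2'" by (fact b)+
  show "g\<^sub>1 = g\<^sub>1'"
  proof (intro eq_matI)
    fix i j assume ij: "i < dim_row g\<^sub>1'" "j < dim_col g\<^sub>1'"
    then have "(g\<^sub>1 + z * Y) $$ (i, j) = (g\<^sub>1' + z * Y) $$ (i, j)"
      using b Y by simp
    then show "g\<^sub>1 $$ (i, j) = g\<^sub>1' $$ (i, j)"
      using ij c by simp
  qed (use c in auto)
qed

context ultrametric_field
begin

text \<open>The Iwahori factorization.  Its unipotent factor is \<open>Y = D\<^sup>-\<^sup>1 C\<close> for the lower blocks \<open>C\<close> and \<open>D\<close>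
  of \<open>q\<close>.\<close>

lemma congruence_subgroup_cell_point:
  assumes q: "q \<in> congruence_subgroup (a + b) \<epsilon>" and \<epsilon>: "0 \<le> \<epsilon>" "\<epsilon> < 1"
  obtains g\<^sub>1 z g\<^sub>2 Y where "g\<^sub>1 \<in> congruence_subgroup a \<epsilon>" "z \<in> carrier_mat a b"
    "g\<^sub>2 \<in> congruence_subgroup b \<epsilon>" "Y \<in> carrier_mat b a" "mat_bounded \<epsilon> Y"
    "q = cell_point g\<^sub>1 z g\<^sub>2 Y"
proof -
  have qc: "q \<in> carrier_mat (a + b) (a + b)" and qb: "mat_bounded \<epsilon> (q - 1\<^sub>m (a + b))"
    using q by (auto simp: congruence_subgroup_def)
  define A where "A = Matrix.mat a a (\<lambda>(i, j). q $$ (i, j))"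
  define B where "B = Matrix.mat a b (\<lambda>(i, j). q $$ (i, a + j))"
  define C where "C = Matrix.mat b a (\<lambda>(i, j). q $$ (a + i, j))"
  define D where "D = Matrix.mat b b (\<lambda>(i, j). q $$ (a + i, a + j))"
  have c: "A \<in> carrier_mat a a" "B \<in> carrier_mat a b" "C \<in> carrier_mat b a" "D \<in> carrier_mat b b"
    by (auto simp: A_def B_def C_def D_def)
  have q_eq: "q = four_block_mat A B C D"
    using qc by (intro eq_matI) (auto simp: A_def B_def C_def D_def)
  have entry: "av (q $$ (i, j) - (if i = j then 1 else 0)) \<le> \<epsilon>" if "i < a + b" "j < a + b" for i j
    using qb qc that by (auto simp: mat_bounded_def)
  have Ab: "mat_bounded \<epsilon> (A - 1\<^sub>m a)"
    unfolding mat_bounded_def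
  proof (intro allI impI)
    fix i j assume "i < dim_row (A - 1\<^sub>m a)" "j < dim_col (A - 1\<^sub>m a)"
    then show "av ((A - 1\<^sub>m a) $$ (i, j)) \<le> \<epsilon>"
      using entry[of i j] c by (simp add: A_def)
  qed
  have Bb: "mat_bounded \<epsilon> B"
    unfolding mat_bounded_def
  proof (intro allI impI)
    fix i j assume "i < dim_row B" "j < dim_col B"
    then show "av (B $$ (i, j)) \<le> \<epsilon>"
      using entry[of i "a + j"] c by (simp add: B_def)
  qed
  have Cb: "mat_bounded \<epsilon> C"
    unfolding mat_bounded_def
  proof (intro allI impI)
    fix i j assume "i < dim_row C" "j < dim_col C"
    then show "av (C $$ (i, j)) \<le> \<epsilon>"
      using entry[of "a + i" j] c by (simp add: C_def)
  qed
  have "mat_bounded \<epsilon> (D - 1\<^sub>m b)"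
    unfolding mat_bounded_def
  proof (intro allI impI)
    fix i j assume "i < dim_row (D - 1\<^sub>m b)" "j < dim_col (D - 1\<^sub>m b)"
    then show "av ((D - 1\<^sub>m b) $$ (i, j)) \<le> \<epsilon>"
      using entry[of "a + i" "a + j"] c by (simp add: D_def)
  qed
  then have D: "D \<in> congruence_subgroup b \<epsilon>"
    using c by (simp add: congruence_subgroup_def)
  obtain D' where D': "D' \<in> congruence_subgroup b \<epsilon>" "D * D' = 1\<^sub>m b"
    using congruence_subgroup_inverse[OF D \<epsilon>] by blast
  have D'c: "D' \<in> carrier_mat b b"
    using D'(1) by (simp add: congruence_subgroup_def)
  define Y where "Y = D' * C"
  have Y: "Y \<in> carrier_mat b a"
    using D'c c by (simp add: Y_def)
  have "mat_bounded (1 * \<epsilon>) Y"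
    unfolding Y_def using D'c c Cb congruence_subgroup_bounded[OF D'(1)] \<epsilon>
    by (intro mat_bounded_mult[of _ b b _ a]) auto
  then have Yb: "mat_bounded \<epsilon> Y" by simp
  have DY: "D * Y = C"
    using c D'c D'(2) by (simp add: Y_def flip: assoc_mult_mat[of _ b b _ b _ a])
  have "mat_bounded (\<epsilon> * \<epsilon>) (B * Y)"
    using c Y Bb Yb \<epsilon> by (intro mat_bounded_mult[of _ a b _ a]) auto
  then have "mat_bounded \<epsilon> (B * Y)"
    by (rule mat_bounded_mono) (use \<epsilon> in \<open>simp add: mult_left_le\<close>)
  then have "mat_bounded \<epsilon> ((A - 1\<^sub>m a) - B * Y)"
    using c Y Ab by (intro mat_bounded_minus[of "A - 1\<^sub>m a" a a "B * Y"]) (auto simp: minus_carrier_mat)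
  moreover have "(A - 1\<^sub>m a) - B * Y = (A - B * Y) - 1\<^sub>m a"
    using c Y by (intro eq_matI) auto
  ultimately have A: "A - B * Y \<in> congruence_subgroup a \<epsilon>"
    using c Y by (simp add: congruence_subgroup_def minus_carrier_mat)
  have "A - B * Y + B * Y = A"
    using c Y by (intro eq_matI) auto
  then have "q = cell_point (A - B * Y) B D Y"
    unfolding cell_point_def by (simp add: q_eq DY)
  with A c(2) D Y Yb show thesis
    using that by blast
qed

lemma lower_in_congruence_subgroup:
  assumes "Y \<in> carrier_mat b a" "mat_bounded \<epsilon> Y" "0 \<le> \<epsilon>"
  shows "cell_point (1\<^sub>m a) (0\<^sub>m a b) (1\<^sub>m b) Y \<in> congruence_subgroup (a + b) \<epsilon>"
proof -
  have "mat_bounded \<epsilon> (cell_point (1\<^sub>m a) (0\<^sub>m a b) (1\<^sub>m b) Y - 1\<^sub>m (a + b))"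
    unfolding mat_bounded_def cell_point_def
  proof (intro allI impI)
    let ?L = "four_block_mat (1\<^sub>m a + 0\<^sub>m a b * Y) (0\<^sub>m a b) (1\<^sub>m b * Y) (1\<^sub>m b)"
    fix i j assume "i < dim_row (?L - 1\<^sub>m (a + b))" "j < dim_col (?L - 1\<^sub>m (a + b))"
    then show "av ((?L - 1\<^sub>m (a + b)) $$ (i, j)) \<le> \<epsilon>"
      using assms by (auto simp: mat_bounded_def)
  qed
  then show ?thesis
    using assms(1) by (simp add: congruence_subgroup_def cell_point_def)
qed

definition in_cell :: "nat \<Rightarrow> nat \<Rightarrow> real \<Rightarrow> 'f mat \<Rightarrow> 'f mat \<Rightarrow> 'f mat \<Rightarrow> bool"
  where "in_cell a b \<epsilon> x g\<^sub>1 g\<^sub>2 \<longleftrightarrow> g\<^sub>1 \<in> GL a \<and> g\<^sub>2 \<in> GL b \<and>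
    (\<exists>z\<in>carrier_mat a b. \<exists>Y\<in>carrier_mat b a. mat_bounded \<epsilon> Y \<and> x = cell_point g\<^sub>1 z g\<^sub>2 Y)"

lemma in_cell_unique:
  assumes "in_cell a b \<epsilon> x g\<^sub>1 g\<^sub>2" "in_cell a b \<epsilon>' x g\<^sub>1' g\<^sub>2'"
  shows "g\<^sub>1 = g\<^sub>1'" "g\<^sub>2 = g\<^sub>2'"
  using assms cell_point_inject(1,3)[of g\<^sub>1 _ g\<^sub>2 _ g\<^sub>1' _ g\<^sub>2' _ a b]
  unfolding in_cell_def by (metis GL_carrier)+

lemma in_cell_mult_left:
  assumes "in_cell a b \<epsilon> x g\<^sub>1 g\<^sub>2" "h\<^sub>1 \<in> GL a" "w \<in> carrier_mat a b" "h\<^sub>2 \<in> GL b"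
  shows "in_cell a b \<epsilon> (four_block_mat h\<^sub>1 w (0\<^sub>m b a) h\<^sub>2 * x) (h\<^sub>1 * g\<^sub>1) (h\<^sub>2 * g\<^sub>2)"
proof -
  obtain z Y where *: "z \<in> carrier_mat a b" "Y \<in> carrier_mat b a" "mat_bounded \<epsilon> Y"
      "x = cell_point g\<^sub>1 z g\<^sub>2 Y" "g\<^sub>1 \<in> GL a" "g\<^sub>2 \<in> GL b"
    using assms(1) by (auto simp: in_cell_def)
  note c = GL_carrier[OF assms(2)] GL_carrier[OF assms(4)] GL_carrier[OF *(5)] GL_carrier[OF *(6)]
  have "four_block_mat h\<^sub>1 w (0\<^sub>m b a) h\<^sub>2 * x = cell_point (h\<^sub>1 * g\<^sub>1) (h\<^sub>1 * z + w * g\<^sub>2) (h\<^sub>2 * g\<^sub>2) Y"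
    unfolding *(4) using c * assms(3) by (intro mult_four_block_upper) auto
  moreover have "h\<^sub>1 * z + w * g\<^sub>2 \<in> carrier_mat a b"
    using c * assms(3) by simp
  ultimately show ?thesis
    unfolding in_cell_def using *(2,3,5,6) assms(2,4) mult_in_GL by blast
qed

text \<open>A point of the support is an element of the parabolic subgroup times a lower unipotent element
  that itself lies in the congruence subgroup, so it suffices to factorize the product of the latter
  with \<open>k\<close>.\<close>

lemma in_cell_mult_right:
  assumes x: "in_cell a b \<epsilon> x g\<^sub>1 g\<^sub>2" and k: "k \<in> congruence_subgroup (a + b) \<epsilon>"
    and \<epsilon>: "0 \<le> \<epsilon>" "\<epsilon> < 1"
  obtains k\<^sub>1 k\<^sub>2 where "k\<^sub>1 \<in> congruence_subgroup a \<epsilon>" "k\<^sub>2 \<in> congruence_subgroup b \<epsilon>"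
    "in_cell a b \<epsilon> (x * k) (g\<^sub>1 * k\<^sub>1) (g\<^sub>2 * k\<^sub>2)"
proof -
  obtain z Y where *: "z \<in> carrier_mat a b" "Y \<in> carrier_mat b a" "mat_bounded \<epsilon> Y"
      "x = cell_point g\<^sub>1 z g\<^sub>2 Y" "g\<^sub>1 \<in> GL a" "g\<^sub>2 \<in> GL b"
    using x by (auto simp: in_cell_def)
  note c = GL_carrier[OF *(5)] GL_carrier[OF *(6)]
  let ?L = "cell_point (1\<^sub>m a) (0\<^sub>m a b) (1\<^sub>m b) Y"
  let ?P = "four_block_mat g\<^sub>1 z (0\<^sub>m b a) g\<^sub>2"
  have L: "?L \<in> congruence_subgroup (a + b) \<epsilon>"
    using * \<epsilon> by (intro lower_in_congruence_subgroup) auto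
  have "?L * k \<in> congruence_subgroup (a + b) \<epsilon>"
    using L k \<epsilon> by (intro congruence_subgroup_mult) auto
  then obtain k\<^sub>1 z' k\<^sub>2 Y' where k': "k\<^sub>1 \<in> congruence_subgroup a \<epsilon>" "z' \<in> carrier_mat a b"
      "k\<^sub>2 \<in> congruence_subgroup b \<epsilon>" "Y' \<in> carrier_mat b a" "mat_bounded \<epsilon> Y'"
      "?L * k = cell_point k\<^sub>1 z' k\<^sub>2 Y'"
    using congruence_subgroup_cell_point \<epsilon> by metis
  have "in_cell a b \<epsilon> (?L * k) k\<^sub>1 k\<^sub>2"
    unfolding in_cell_def using k' congruence_subgroup_in_GL \<epsilon> by metis
  then have "in_cell a b \<epsilon> (?P * (?L * k)) (g\<^sub>1 * k\<^sub>1) (g\<^sub>2 * k\<^sub>2)"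
    using * by (intro in_cell_mult_left) auto
  moreover have "x * k = ?P * (?L * k)"
  proof -
    have "x = ?P * ?L"
      unfolding *(4) using c * by (intro cell_point_upper) auto
    moreover have "?P \<in> carrier_mat (a + b) (a + b)" "?L \<in> carrier_mat (a + b) (a + b)"
        "k \<in> carrier_mat (a + b) (a + b)"
      using c L k by (auto simp: congruence_subgroup_def)
    ultimately show ?thesis
      by (simp add: assoc_mult_mat[of _ "a + b" "a + b" _ "a + b" _ "a + b"])
  qed
  ultimately show thesis
    using that k' by metis
qed

text \<open>The value is unique by \<open>in_cell_unique\<close>.  The radius \<open>\<epsilon>\<close> bounds only the block \<open>Y\<close>, so the
  support is compact modulo the parabolic subgroup.\<close>

definition cell_function :: "nat \<Rightarrow> nat \<Rightarrow> real \<Rightarrow> ('f mat \<Rightarrow> 'f mat \<Rightarrow> 'x::zero) \<Rightarrow> 'f mat \<Rightarrow> 'x"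
  where "cell_function a b \<epsilon> \<phi> x = (if \<exists>g\<^sub>1 g\<^sub>2. in_cell a b \<epsilon> x g\<^sub>1 g\<^sub>2
    then (THE t. \<exists>g\<^sub>1 g\<^sub>2. in_cell a b \<epsilon> x g\<^sub>1 g\<^sub>2 \<and> t = \<phi> g\<^sub>1 g\<^sub>2) else 0)"

lemma cell_function_eq:
  assumes "in_cell a b \<epsilon> x g\<^sub>1 g\<^sub>2"
  shows "cell_function a b \<epsilon> \<phi> x = \<phi> g\<^sub>1 g\<^sub>2"
proof -
  have "(THE t. \<exists>g\<^sub>1 g\<^sub>2. in_cell a b \<epsilon> x g\<^sub>1 g\<^sub>2 \<and> t = \<phi> g\<^sub>1 g\<^sub>2) = \<phi> g\<^sub>1 g\<^sub>2"
    using assms in_cell_unique[OF _ assms] by (intro the_equality) blast+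
  then show ?thesis
    using assms by (auto simp: cell_function_def)
qed

lemma cell_function_eq_0:
  "(\<And>g\<^sub>1 g\<^sub>2. \<not> in_cell a b \<epsilon> x g\<^sub>1 g\<^sub>2) \<Longrightarrow> cell_function a b \<epsilon> \<phi> x = 0"
  by (simp add: cell_function_def)

lemma cell_function_mult_right:
  assumes \<phi>: "\<And>g\<^sub>1 g\<^sub>2 k\<^sub>1 k\<^sub>2. g\<^sub>1 \<in> GL a \<Longrightarrow> g\<^sub>2 \<in> GL b \<Longrightarrow> k\<^sub>1 \<in> congruence_subgroup a \<epsilon> \<Longrightarrow>
      k\<^sub>2 \<in> congruence_subgroup b \<epsilon> \<Longrightarrow> \<phi> (g\<^sub>1 * k\<^sub>1) (g\<^sub>2 * k\<^sub>2) = \<phi> g\<^sub>1 g\<^sub>2"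
    and x: "x \<in> carrier_mat (a + b) (a + b)"
    and k: "k \<in> congruence_subgroup (a + b) \<epsilon>" and \<epsilon>: "0 \<le> \<epsilon>" "\<epsilon> < 1"
  shows "cell_function a b \<epsilon> \<phi> (x * k) = cell_function a b \<epsilon> \<phi> x"
proof (cases "\<exists>g\<^sub>1 g\<^sub>2. in_cell a b \<epsilon> x g\<^sub>1 g\<^sub>2")
  case True
  then obtain g\<^sub>1 g\<^sub>2 where g: "in_cell a b \<epsilon> x g\<^sub>1 g\<^sub>2" by blast
  then obtain k\<^sub>1 k\<^sub>2 where k12: "k\<^sub>1 \<in> congruence_subgroup a \<epsilon>" "k\<^sub>2 \<in> congruence_subgroup b \<epsilon>"
      "in_cell a b \<epsilon> (x * k) (g\<^sub>1 * k\<^sub>1) (g\<^sub>2 * k\<^sub>2)"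
    using in_cell_mult_right[OF g k \<epsilon>] by blast
  have "g\<^sub>1 \<in> GL a" "g\<^sub>2 \<in> GL b"
    using g by (auto simp: in_cell_def)
  then show ?thesis
    using cell_function_eq[OF g] cell_function_eq[OF k12(3)] \<phi> k12(1,2) by metis
next
  case False
  \<comment> \<open>The complement of the support is stable under the group as well.\<close>
  obtain k' where k': "k' \<in> congruence_subgroup (a + b) \<epsilon>" "k * k' = 1\<^sub>m (a + b)"
    using congruence_subgroup_inverse[OF k \<epsilon>] by blast
  have "k \<in> carrier_mat (a + b) (a + b)" "k' \<in> carrier_mat (a + b) (a + b)"
    using k k' by (auto simp: congruence_subgroup_def)
  then have "x * k * k' = x"
    using x k'(2) by (simp add: assoc_mult_mat[of _ "a + b" "a + b" _ "a + b" _ "a + b"])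
  then have "\<not> in_cell a b \<epsilon> (x * k) g\<^sub>1 g\<^sub>2" for g\<^sub>1 g\<^sub>2
    using False in_cell_mult_right[of a b \<epsilon> "x * k" g\<^sub>1 g\<^sub>2 k', OF _ k'(1) \<epsilon>] by metis
  then show ?thesis
    using False by (simp add: cell_function_eq_0)
qed

lemma modulus_mult:
  assumes "g\<^sub>1 \<in> carrier_mat a a" "h\<^sub>1 \<in> carrier_mat a a" "g\<^sub>2 \<in> carrier_mat b b" "h\<^sub>2 \<in> carrier_mat b b"
  shows "modulus av a b (h\<^sub>1 * g\<^sub>1) (h\<^sub>2 * g\<^sub>2) = modulus av a b h\<^sub>1 h\<^sub>2 * modulus av a b g\<^sub>1 g\<^sub>2"
  using assms by (simp add: modulus_def det_mult av_mult power_mult_distrib)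

text \<open>When the congruence subgroups of radius \<open>\<epsilon>\<close> fix \<open>v\<close> and \<open>w\<close>, this is the function in the
  induced space that has value \<open>v \<otimes> w\<close> at \<open>1\<close>, is supported on \<open>P K\<close> for \<open>P\<close> the parabolic subgroup
  and \<open>K\<close> the congruence subgroup of radius \<open>\<epsilon>\<close> in \<open>GL (a + b)\<close>, and is fixed by \<open>K\<close>.\<close>

definition bump :: "nat \<Rightarrow> nat \<Rightarrow> ('f mat \<Rightarrow> 'v::complex_vector \<Rightarrow> 'v) \<Rightarrow>
    ('f mat \<Rightarrow> 'w::complex_vector \<Rightarrow> 'w) \<Rightarrow> real \<Rightarrow> 'v \<Rightarrow> 'w \<Rightarrow> 'f mat \<Rightarrow> ('v, 'w) tensor"
  where "bump a b \<sigma> \<tau> \<epsilon> v w = cell_function a b \<epsilon>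
    (\<lambda>g\<^sub>1 g\<^sub>2. complex_of_real (sqrt (modulus av a b g\<^sub>1 g\<^sub>2)) *\<^sub>C (\<sigma> g\<^sub>1 v \<otimes>\<^sub>C \<tau> g\<^sub>2 w))"

lemma bump_mult_left:
  assumes \<sigma>: "smooth_rep av a \<sigma>" and \<tau>: "smooth_rep av b \<tau>"
    and h: "h\<^sub>1 \<in> GL a" "h\<^sub>2 \<in> GL b" "z \<in> carrier_mat a b" and x: "x \<in> carrier_mat (a + b) (a + b)"
  shows "bump a b \<sigma> \<tau> \<epsilon> v w (four_block_mat h\<^sub>1 z (0\<^sub>m b a) h\<^sub>2 * x) =
    complex_of_real (sqrt (modulus av a b h\<^sub>1 h\<^sub>2)) *\<^sub>C
      tensor_map (\<sigma> h\<^sub>1) (\<tau> h\<^sub>2) (bump a b \<sigma> \<tau> \<epsilon> v w x)"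
proof -
  let ?P = "four_block_mat h\<^sub>1 z (0\<^sub>m b a) h\<^sub>2"
  have lin: "clinear (\<sigma> h\<^sub>1)" "clinear (\<tau> h\<^sub>2)"
    using \<sigma> \<tau> h by (auto simp: smooth_rep_def)
  show ?thesis
  proof (cases "\<exists>g\<^sub>1 g\<^sub>2. in_cell a b \<epsilon> x g\<^sub>1 g\<^sub>2")
    case True
    then obtain g\<^sub>1 g\<^sub>2 where g: "in_cell a b \<epsilon> x g\<^sub>1 g\<^sub>2" by blast
    then have GL: "g\<^sub>1 \<in> GL a" "g\<^sub>2 \<in> GL b"
      by (auto simp: in_cell_def)
    have "\<sigma> (h\<^sub>1 * g\<^sub>1) v = \<sigma> h\<^sub>1 (\<sigma> g\<^sub>1 v)" "\<tau> (h\<^sub>2 * g\<^sub>2) w = \<tau> h\<^sub>2 (\<tau> g\<^sub>2 w)"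
      using \<sigma> \<tau> h GL by (auto simp: smooth_rep_def)
    moreover have "modulus av a b (h\<^sub>1 * g\<^sub>1) (h\<^sub>2 * g\<^sub>2) = modulus av a b h\<^sub>1 h\<^sub>2 * modulus av a b g\<^sub>1 g\<^sub>2"
      using h GL by (intro modulus_mult GL_carrier)
    ultimately show ?thesis
      unfolding bump_def cell_function_eq[OF g] cell_function_eq[OF in_cell_mult_left[OF g h(1,3,2)]]
      by (simp add: clinear_scale[OF clinear_tensor_map[OF lin]] tensor_map_tensor[OF lin]
          real_sqrt_mult scaleC_scaleC)
  next
    case False
    obtain h\<^sub>1' z' h\<^sub>2' where h': "h\<^sub>1' \<in> GL a" "z' \<in> carrier_mat a b" "h\<^sub>2' \<in> GL b"
        "?P * four_block_mat h\<^sub>1' z' (0\<^sub>m b a) h\<^sub>2' = 1\<^sub>m (a + b)"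
      using four_block_upper_inverse[OF h(1,3,2)] .
    have P: "?P \<in> carrier_mat (a + b) (a + b)"
        "four_block_mat h\<^sub>1' z' (0\<^sub>m b a) h\<^sub>2' \<in> carrier_mat (a + b) (a + b)"
      using h h' by (simp_all add: GL_carrier)
    have "four_block_mat h\<^sub>1' z' (0\<^sub>m b a) h\<^sub>2' * ?P = 1\<^sub>m (a + b)"
      by (rule mat_mult_left_right_inverse[OF P h'(4)])
    with P have "four_block_mat h\<^sub>1' z' (0\<^sub>m b a) h\<^sub>2' * (?P * x) = x"
      using x by (simp flip: assoc_mult_mat[of _ "a + b" "a + b" _ "a + b" _ "a + b"])
    then have "\<not> in_cell a b \<epsilon> (?P * x) g\<^sub>1 g\<^sub>2" for g\<^sub>1 g\<^sub>2
      using False in_cell_mult_left[of a b \<epsilon> "?P * x" g\<^sub>1 g\<^sub>2, OF _ h'(1,2,3)] by metis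
    moreover have "tensor_map (\<sigma> h\<^sub>1) (\<tau> h\<^sub>2) 0 = 0"
      using clinear_scale[OF clinear_tensor_map[OF lin], of 0 0] by simp
    ultimately show ?thesis
      using False by (simp add: bump_def cell_function_eq_0)
  qed
qed

lemma bump_mult_right:
  assumes \<sigma>: "smooth_rep av a \<sigma>" and \<tau>: "smooth_rep av b \<tau>"
    and v: "\<And>k. k \<in> congruence_subgroup a \<epsilon> \<Longrightarrow> \<sigma> k v = v"
    and w: "\<And>k. k \<in> congruence_subgroup b \<epsilon> \<Longrightarrow> \<tau> k w = w"
    and x: "x \<in> carrier_mat (a + b) (a + b)"
    and k: "k \<in> congruence_subgroup (a + b) \<epsilon>" and \<epsilon>: "0 \<le> \<epsilon>" "\<epsilon> < 1"
  shows "bump a b \<sigma> \<tau> \<epsilon> v w (x * k) = bump a b \<sigma> \<tau> \<epsilon> v w x"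
  unfolding bump_def
proof (rule cell_function_mult_right[OF _ x k \<epsilon>])
  fix g\<^sub>1 g\<^sub>2 k\<^sub>1 k\<^sub>2 :: "'f mat"
  assume g: "g\<^sub>1 \<in> GL a" "g\<^sub>2 \<in> GL b"
    and k: "k\<^sub>1 \<in> congruence_subgroup a \<epsilon>" "k\<^sub>2 \<in> congruence_subgroup b \<epsilon>"
  have kGL: "k\<^sub>1 \<in> GL a" "k\<^sub>2 \<in> GL b"
    using k \<epsilon> congruence_subgroup_in_GL by blast+
  have "\<sigma> (g\<^sub>1 * k\<^sub>1) v = \<sigma> g\<^sub>1 v" "\<tau> (g\<^sub>2 * k\<^sub>2) w = \<tau> g\<^sub>2 w"
    using \<sigma> \<tau> g kGL v[OF k(1)] w[OF k(2)] by (auto simp: smooth_rep_def)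
  moreover have "modulus av a b k\<^sub>1 k\<^sub>2 = 1"
    using av_det_congruence_subgroup k \<epsilon> by (simp add: modulus_def)
  then have "modulus av a b (g\<^sub>1 * k\<^sub>1) (g\<^sub>2 * k\<^sub>2) = modulus av a b g\<^sub>1 g\<^sub>2"
    using modulus_mult g kGL GL_carrier by (metis mult.right_neutral)
  ultimately show "complex_of_real (sqrt (modulus av a b (g\<^sub>1 * k\<^sub>1) (g\<^sub>2 * k\<^sub>2))) *\<^sub>C
        (\<sigma> (g\<^sub>1 * k\<^sub>1) v \<otimes>\<^sub>C \<tau> (g\<^sub>2 * k\<^sub>2) w) =
      complex_of_real (sqrt (modulus av a b g\<^sub>1 g\<^sub>2)) *\<^sub>C (\<sigma> g\<^sub>1 v \<otimes>\<^sub>C \<tau> g\<^sub>2 w)"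
    by simp
qed

text \<open>The translate is fixed by \<open>g K g\<^sup>-\<^sup>1\<close>, which contains a smaller congruence subgroup: conjugation
  by \<open>g\<close> stretches entries by a bounded factor.\<close>

lemma right_translation_bump_in_induced_space:
  assumes \<sigma>: "smooth_rep av a \<sigma>" and \<tau>: "smooth_rep av b \<tau>"
    and v: "\<And>k. k \<in> congruence_subgroup a \<epsilon> \<Longrightarrow> \<sigma> k v = v"
    and w: "\<And>k. k \<in> congruence_subgroup b \<epsilon> \<Longrightarrow> \<tau> k w = w"
    and \<epsilon>: "0 < \<epsilon>" "\<epsilon> < 1" and g: "g \<in> GL (a + b)"
  shows "right_translation (a + b) g (bump a b \<sigma> \<tau> \<epsilon> v w) \<in> induced_space av a b \<sigma> \<tau>"
  (is "?f \<in> _")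
  unfolding induced_space_def mem_Collect_eq
proof (intro conjI allI impI ballI)
  fix x :: "'f mat" assume "x \<notin> GL (a + b)"
  then show "?f x = 0" by (simp add: right_translation_def)
next
  fix h\<^sub>1 h\<^sub>2 z x :: "'f mat"
  assume h: "h\<^sub>1 \<in> GL a" "h\<^sub>2 \<in> GL b" "z \<in> carrier_mat a b" and x: "x \<in> GL (a + b)"
  let ?P = "four_block_mat h\<^sub>1 z (0\<^sub>m b a) h\<^sub>2"
  have P: "?P \<in> GL (a + b)"
    using h by (intro four_block_upper_in_GL)
  have "?P * x * g = ?P * (x * g)"
    using GL_carrier[OF P] GL_carrier[OF x] GL_carrier[OF g]
    by (simp add: assoc_mult_mat[of _ "a + b" "a + b" _ "a + b" _ "a + b"])
  then show "?f (?P * x) = complex_of_real (sqrt (modulus av a b h\<^sub>1 h\<^sub>2)) *\<^sub>C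
      tensor_map (\<sigma> h\<^sub>1) (\<tau> h\<^sub>2) (?f x)"
    using bump_mult_left[OF \<sigma> \<tau> h GL_carrier[OF mult_in_GL[OF x g]]] mult_in_GL[OF P x] x
    by (simp add: right_translation_def)
next
  let ?m = "a + b"
  obtain g' where g': "g' \<in> GL ?m" and inv: "g * g' = 1\<^sub>m ?m" "g' * g = 1\<^sub>m ?m"
    using GL_inverse[OF g] .
  obtain r where r: "0 < r" "mat_bounded r g"
    using mat_bounded_exists .
  obtain s where s: "0 < s" "mat_bounded s g'"
    using mat_bounded_exists .
  show "smooth_vector av ?m (right_translation ?m) ?f"
  proof (rule smooth_vectorI)
    fix x y :: "'f mat" assume xy: "x \<in> GL ?m" "y \<in> GL ?m"
    show "right_translation ?m (x * y) ?f = right_translation ?m x (right_translation ?m y ?f)"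
    proof
      fix u :: "'f mat"
      show "right_translation ?m (x * y) ?f u = right_translation ?m x (right_translation ?m y ?f) u"
      proof (cases "u \<in> GL ?m")
        case True
        then have "u * x \<in> GL ?m" using xy mult_in_GL by blast
        moreover have "u * (x * y) = u * x * y"
          using GL_carrier[OF True] GL_carrier[OF xy(1)] GL_carrier[OF xy(2)]
          by (simp add: assoc_mult_mat[of _ ?m ?m _ ?m _ ?m])
        ultimately show ?thesis
          using True by (simp add: right_translation_def)
      qed (simp add: right_translation_def)
    qed
  next
    show "0 < \<epsilon> / (s * r)"
      using \<epsilon> r s by simp
    fix k assume k: "k \<in> GL ?m" "k \<in> congruence_subgroup ?m (\<epsilon> / (s * r))"
    note c = GL_carrier[OF g] GL_carrier[OF g'] GL_carrier[OF k(1)]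
    have kb: "mat_bounded (\<epsilon> / (s * r)) (k - 1\<^sub>m ?m)"
      using k(2) by (simp add: congruence_subgroup_def)
    have "g' * k * g - 1\<^sub>m ?m = g' * (k - 1\<^sub>m ?m) * g"
      using c inv by (simp add: mult_minus_distrib_mat[of _ ?m ?m _ ?m] minus_mult_distrib_mat[of _ ?m ?m])
    moreover have "mat_bounded (s * (\<epsilon> / (s * r)) * r) (g' * (k - 1\<^sub>m ?m) * g)"
      using c kb r s \<epsilon>
      by (intro mat_bounded_mult[of _ ?m ?m _ ?m]) (auto simp: minus_carrier_mat intro!: mult_carrier_mat)
    ultimately have k': "g' * k * g \<in> congruence_subgroup ?m \<epsilon>"
      using c r s by (simp add: congruence_subgroup_def)
    show "right_translation ?m k ?f = ?f"
    proof
      fix x :: "'f mat"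
      show "right_translation ?m k ?f x = ?f x"
      proof (cases "x \<in> GL ?m")
        case True
        note xc = GL_carrier[OF True]
        have "x * g * (g' * k * g) = x * (g * g') * (k * g)"
          using c xc by (simp add: assoc_mult_mat[of _ ?m ?m _ ?m _ ?m])
        then have "x * g * (g' * k * g) = x * k * g"
          using c xc inv by (simp add: assoc_mult_mat[of _ ?m ?m _ ?m _ ?m])
        then have "bump a b \<sigma> \<tau> \<epsilon> v w (x * k * g) = bump a b \<sigma> \<tau> \<epsilon> v w (x * g)"
          using bump_mult_right[OF \<sigma> \<tau> v w _ k', of "x * g"] c xc \<epsilon> by simp
        then show ?thesis
          using True mult_in_GL[OF True k(1)] by (simp add: right_translation_def)
      qed (simp add: right_translation_def)
    qed
  qed
qed

end

section \<open>Averaging over large compact subgroups of the unipotent radical\<close>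

text \<open>The entries \<open>x\<close> are a function on index pairs because these functions form an additive group as
  a type, unlike the matrices.  Entries outside the \<open>n \<times> n\<close> square are ignored here, and vanish on the
  subgroups \<open>matrix_ball n R\<close> below.\<close>

definition upper_unipotent :: "nat \<Rightarrow> (nat \<times> nat \<Rightarrow> 'f::field) \<Rightarrow> 'f mat"
  where "upper_unipotent n x = four_block_mat (1\<^sub>m n) (Matrix.mat n n x) (0\<^sub>m n n) (1\<^sub>m n)"

definition index_trace :: "nat \<Rightarrow> (nat \<times> nat \<Rightarrow> 'f::field) \<Rightarrow> 'f"
  where "index_trace n x = (\<Sum>i<n. x (i, i))"

lemma index_trace_add: "index_trace n (x + y) = index_trace n x + index_trace n y"
  by (simp only: index_trace_def plus_fun_apply sum.distrib)

lemma upper_unipotent_carrier: "upper_unipotent n x \<in> carrier_mat (2 * n) (2 * n)"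
  unfolding upper_unipotent_def mult_2 by (intro four_block_carrier_mat) simp_all

lemma upper_unipotent_add:
  "upper_unipotent n (x + y) = upper_unipotent n x * upper_unipotent n y"
proof -
  have mult: "upper_unipotent n x * upper_unipotent n y =
      four_block_mat (1\<^sub>m n) (Matrix.mat n n y + Matrix.mat n n x) (0\<^sub>m n n) (1\<^sub>m n)"
    unfolding upper_unipotent_def
    by (subst mult_four_block_mat[of _ n n _ n _ n _ _ n _ n]) simp_all
  have "Matrix.mat n n (x + y) = Matrix.mat n n y + Matrix.mat n n x"
    by (intro eq_matI) simp_all
  then show ?thesis
    unfolding mult by (simp only: upper_unipotent_def)
qed

lemma upper_unipotent_0: "upper_unipotent n 0 = 1\<^sub>m (2 * n)"
proof -
  have "Matrix.mat n n (0 :: nat \<times> nat \<Rightarrow> 'a) = 0\<^sub>m n n"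
    by (intro eq_matI) simp_all
  then show ?thesis
    by (simp only: upper_unipotent_def mult_2 four_block_one_mat)
qed

lemma upper_unipotent_in_GL: "upper_unipotent n x \<in> GL (2 * n)"
proof (rule GL_I)
  have "upper_unipotent n x * upper_unipotent n (- x) = upper_unipotent n (x + (- x))"
    by (rule upper_unipotent_add[symmetric])
  also have "x + (- x) = 0" by (rule right_minus)
  finally show "upper_unipotent n x * upper_unipotent n (- x) = 1\<^sub>m (2 * n)"
    by (simp only: upper_unipotent_0)
qed (rule upper_unipotent_carrier)+

context ultrametric_field
begin

definition matrix_ball :: "nat \<Rightarrow> real \<Rightarrow> (nat \<times> nat \<Rightarrow> 'f) set"
  where "matrix_ball n R = {x. (\<forall>i<n. \<forall>j<n. av (x (i, j)) \<le> R) \<and>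
    (\<forall>i j. \<not> (i < n \<and> j < n) \<longrightarrow> x (i, j) = 0)}"

lemma matrix_ballI:
  assumes "\<And>i j. i < n \<Longrightarrow> j < n \<Longrightarrow> av (x (i, j)) \<le> R"
    and "\<And>i j. \<not> (i < n \<and> j < n) \<Longrightarrow> x (i, j) = 0"
  shows "x \<in> matrix_ball n R"
  unfolding matrix_ball_def mem_Collect_eq by (intro conjI allI impI assms)

lemma matrix_ball_av_le: "x \<in> matrix_ball n R \<Longrightarrow> i < n \<Longrightarrow> j < n \<Longrightarrow> av (x (i, j)) \<le> R"
  unfolding matrix_ball_def by blast

lemma matrix_ball_outside: "x \<in> matrix_ball n R \<Longrightarrow> \<not> (i < n \<and> j < n) \<Longrightarrow> x (i, j) = 0"
  unfolding matrix_ball_def by blast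

definition matrix_ball_rel :: "nat \<Rightarrow> real \<Rightarrow> real \<Rightarrow> ((nat \<times> nat \<Rightarrow> 'f) \<times> (nat \<times> nat \<Rightarrow> 'f)) set"
  where "matrix_ball_rel n R \<epsilon> = {(x, y). x \<in> matrix_ball n R \<and> y \<in> matrix_ball n R \<and> x - y \<in> matrix_ball n \<epsilon>}"

text \<open>Up to a positive factor, the integral over the compact group \<open>matrix_ball n R\<close> of a function invariant
  under its open subgroup \<open>matrix_ball n \<epsilon>\<close>.\<close>

definition coset_sum :: "nat \<Rightarrow> real \<Rightarrow> real \<Rightarrow> ((nat \<times> nat \<Rightarrow> 'f) \<Rightarrow> 'x::comm_monoid_add) \<Rightarrow> 'x"
  where "coset_sum n R \<epsilon> \<Phi> = (\<Sum>C\<in>matrix_ball n R // matrix_ball_rel n R \<epsilon>. \<Phi> (SOME x. x \<in> C))"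

definition matrix_ball_periodic :: "nat \<Rightarrow> real \<Rightarrow> ((nat \<times> nat \<Rightarrow> 'f) \<Rightarrow> 'x) \<Rightarrow> bool"
  where "matrix_ball_periodic n \<epsilon> \<Phi> \<longleftrightarrow> (\<forall>x. \<forall>s\<in>matrix_ball n \<epsilon>. \<Phi> (x + s) = \<Phi> x)"

lemma matrix_ball_add:
  assumes "x \<in> matrix_ball n R" "y \<in> matrix_ball n R"
  shows "x + y \<in> matrix_ball n R"
proof (rule matrix_ballI)
  fix i j assume "i < n" "j < n"
  then show "av ((x + y) (i, j)) \<le> R"
    unfolding plus_fun_apply by (intro av_add_le matrix_ball_av_le[OF assms(1)] matrix_ball_av_le[OF assms(2)])
next
  fix i j assume "\<not> (i < n \<and> j < n)"
  then show "(x + y) (i, j) = 0"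
    using matrix_ball_outside[OF assms(1), of i j] matrix_ball_outside[OF assms(2), of i j] by simp
qed

lemma matrix_ball_minus:
  assumes "x \<in> matrix_ball n R"
  shows "- x \<in> matrix_ball n R"
proof (rule matrix_ballI)
  fix i j assume "i < n" "j < n"
  then show "av ((- x) (i, j)) \<le> R"
    using matrix_ball_av_le[OF assms, of i j] by simp
next
  fix i j assume "\<not> (i < n \<and> j < n)"
  then show "(- x) (i, j) = 0"
    using matrix_ball_outside[OF assms, of i j] by simp
qed

lemma matrix_ball_diff: "x \<in> matrix_ball n R \<Longrightarrow> y \<in> matrix_ball n R \<Longrightarrow> x - y \<in> matrix_ball n R"
  using matrix_ball_add[of x n R "- y"] matrix_ball_minus[of y n R] by simp

lemma zero_in_matrix_ball: "0 \<le> R \<Longrightarrow> 0 \<in> matrix_ball n R"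
  by (rule matrix_ballI) simp_all

lemma matrix_ball_mono:
  assumes "R \<le> R'"
  shows "matrix_ball n R \<subseteq> matrix_ball n R'"
proof (intro subsetI matrix_ballI)
  fix x i j assume "x \<in> matrix_ball n R" "i < n" "j < n"
  then show "av (x (i, j)) \<le> R'"
    using matrix_ball_av_le[of x n R i j] assms by linarith
qed (rule matrix_ball_outside)

lemma av_index_trace_le:
  assumes "x \<in> matrix_ball n R" "0 \<le> R"
  shows "av (index_trace n x) \<le> R"
  unfolding index_trace_def
proof (rule av_sum_le[OF assms(2)])
  fix i assume "i \<in> {..<n}"
  then show "av (x (i, i)) \<le> R"
    using matrix_ball_av_le[OF assms(1), of i i] by simp
qed

lemma upper_unipotent_in_congruence_subgroup:
  assumes "s \<in> matrix_ball n \<epsilon>" "0 \<le> \<epsilon>"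
  shows "upper_unipotent n s \<in> congruence_subgroup (2 * n) \<epsilon>"
proof -
  have s: "av (s (i, j)) \<le> \<epsilon>" if "i < n" "j < n" for i j
    using assms(1) that by (rule matrix_ball_av_le)
  have "mat_bounded \<epsilon> (upper_unipotent n s - 1\<^sub>m (2 * n))"
    unfolding mat_bounded_def upper_unipotent_def
    using assms(2) s by auto
  then show ?thesis
    by (simp add: congruence_subgroup_def upper_unipotent_carrier)
qed

lemma equiv_matrix_ball_rel:
  assumes "0 \<le> \<epsilon>"
  shows "equiv (matrix_ball n R) (matrix_ball_rel n R \<epsilon>)"
proof (rule equivI)
  show "matrix_ball_rel n R \<epsilon> \<subseteq> matrix_ball n R \<times> matrix_ball n R"
    by (auto simp: matrix_ball_rel_def)
  show "refl_on (matrix_ball n R) (matrix_ball_rel n R \<epsilon>)"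
    using zero_in_matrix_ball[OF assms] by (auto simp: refl_on_def matrix_ball_rel_def)
  show "sym (matrix_ball_rel n R \<epsilon>)"
    unfolding sym_def matrix_ball_rel_def using matrix_ball_minus by fastforce
  show "trans (matrix_ball_rel n R \<epsilon>)"
    unfolding trans_def matrix_ball_rel_def using matrix_ball_add by fastforce
qed

text \<open>A class is determined by a choice, for each entry, of a ball of radius \<open>\<epsilon>\<close> from a finite cover of
  the ball of radius \<open>R\<close>.\<close>

lemma finite_matrix_ball_quotient:
  assumes cover: "finitely_covered_balls av" and \<epsilon>: "0 < \<epsilon>"
  shows "finite (matrix_ball n R // matrix_ball_rel n R \<epsilon>)"
proof -
  obtain S where S: "finite S" "\<forall>x. av x \<le> R \<longrightarrow> (\<exists>s\<in>S. av (x - s) \<le> \<epsilon>)"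
    using cover \<epsilon> unfolding finitely_covered_balls_def by blast
  then obtain c where c: "\<And>x. av x \<le> R \<Longrightarrow> c x \<in> S" "\<And>x. av x \<le> R \<Longrightarrow> av (x - c x) \<le> \<epsilon>"
    by metis
  define I where "I = {..<n} \<times> {..<n}"
  define code where "code x = restrict (c \<circ> x) I" for x :: "nat \<times> nat \<Rightarrow> 'f"
  have entry: "av (x ij) \<le> R" if "x \<in> matrix_ball n R" "ij \<in> I" for x ij
    using that by (auto simp: I_def intro: matrix_ball_av_le)
  have "code ` matrix_ball n R \<subseteq> Pi\<^sub>E I (\<lambda>_. S)"
    using c(1) entry by (auto simp: code_def)
  moreover have "finite (Pi\<^sub>E I (\<lambda>_. S))"
    using S(1) by (intro finite_PiE) (auto simp: I_def)
  ultimately have fin: "finite (code ` matrix_ball n R)"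
    by (rule finite_subset)
  have same: "matrix_ball_rel n R \<epsilon> `` {x} = matrix_ball_rel n R \<epsilon> `` {y}"
    if xy: "x \<in> matrix_ball n R" "y \<in> matrix_ball n R" "code x = code y" for x y
  proof -
    have "x - y \<in> matrix_ball n \<epsilon>"
    proof (rule matrix_ballI)
      fix i j assume "i < n" "j < n"
      then have ij: "(i, j) \<in> I" by (simp add: I_def)
      have "c (x (i, j)) = c (y (i, j))"
        using fun_cong[OF xy(3), of "(i, j)"] ij by (simp add: code_def)
      then have "(x - y) (i, j) = (x (i, j) - c (x (i, j))) - (y (i, j) - c (y (i, j)))"
        by simp
      also have "av \<dots> \<le> \<epsilon>"
        by (intro av_diff_le c(2) entry[OF xy(1) ij] entry[OF xy(2) ij])
      finally show "av ((x - y) (i, j)) \<le> \<epsilon>" .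
    next
      fix i j assume "\<not> (i < n \<and> j < n)"
      then show "(x - y) (i, j) = 0"
        using matrix_ball_outside[OF xy(1), of i j] matrix_ball_outside[OF xy(2), of i j] by simp
    qed
    then have "(x, y) \<in> matrix_ball_rel n R \<epsilon>"
      using xy by (simp add: matrix_ball_rel_def)
    with equiv_matrix_ball_rel[OF less_imp_le[OF \<epsilon>]] show ?thesis
      by (rule equiv_class_eq)
  qed
  have "matrix_ball n R // matrix_ball_rel n R \<epsilon> \<subseteq>
      (\<lambda>y. matrix_ball_rel n R \<epsilon> `` {inv_into (matrix_ball n R) code y}) ` code ` matrix_ball n R"
  proof
    fix C assume "C \<in> matrix_ball n R // matrix_ball_rel n R \<epsilon>"
    then obtain x where x: "x \<in> matrix_ball n R" "C = matrix_ball_rel n R \<epsilon> `` {x}"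
      by (auto elim: quotientE)
    have "C = matrix_ball_rel n R \<epsilon> `` {inv_into (matrix_ball n R) code (code x)}"
      unfolding x(2) using x(1)
      by (intro same) (auto intro: inv_into_into simp: f_inv_into_f)
    then show "C \<in> (\<lambda>y. matrix_ball_rel n R \<epsilon> `` {inv_into (matrix_ball n R) code y}) ` code ` matrix_ball n R"
      using x(1) by blast
  qed
  then show ?thesis
    using fin by (meson finite_imageI finite_subset)
qed

lemma some_in_coset:
  assumes "0 \<le> \<epsilon>" "C \<in> matrix_ball n R // matrix_ball_rel n R \<epsilon>"
  shows "(SOME x. x \<in> C) \<in> C"
  using in_quotient_imp_non_empty[OF equiv_matrix_ball_rel[OF assms(1)] assms(2)] by (simp add: some_in_eq)

lemma matrix_ball_periodic_coset:
  assumes \<Phi>: "matrix_ball_periodic n \<epsilon> \<Phi>" and C: "C \<in> matrix_ball n R // matrix_ball_rel n R \<epsilon>"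
    and "0 \<le> \<epsilon>" "x \<in> C" "y \<in> C"
  shows "\<Phi> x = \<Phi> y"
proof -
  have "(x, y) \<in> matrix_ball_rel n R \<epsilon>"
    using quotient_eq_iff[OF equiv_matrix_ball_rel[OF \<open>0 \<le> \<epsilon>\<close>] C C assms(4,5)] by simp
  then have "x - y \<in> matrix_ball n \<epsilon>" by (simp add: matrix_ball_rel_def)
  then have "\<Phi> (y + (x - y)) = \<Phi> y"
    using \<Phi> by (simp only: matrix_ball_periodic_def)
  then show ?thesis by simp
qed

lemma translate_coset:
  assumes C: "C \<in> matrix_ball n R // matrix_ball_rel n R \<epsilon>" and t: "t \<in> matrix_ball n R"
  shows "(+) t ` C \<in> matrix_ball n R // matrix_ball_rel n R \<epsilon>"
proof -
  obtain x where x: "x \<in> matrix_ball n R" "C = matrix_ball_rel n R \<epsilon> `` {x}"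
    using C by (auto elim: quotientE)
  have "(+) t ` C = matrix_ball_rel n R \<epsilon> `` {t + x}"
  proof (intro equalityI subsetI)
    fix y assume "y \<in> (+) t ` C"
    then show "y \<in> matrix_ball_rel n R \<epsilon> `` {t + x}"
      using t x by (auto simp: matrix_ball_rel_def intro: matrix_ball_add)
  next
    fix y assume y: "y \<in> matrix_ball_rel n R \<epsilon> `` {t + x}"
    then have "y - t \<in> matrix_ball n R" "x - (y - t) \<in> matrix_ball n \<epsilon>"
      using t by (auto simp: matrix_ball_rel_def algebra_simps intro: matrix_ball_diff)
    then have "y - t \<in> C"
      using x by (simp add: matrix_ball_rel_def)
    then have "t + (y - t) \<in> (+) t ` C"
      by (rule imageI)
    then show "y \<in> (+) t ` C" by simp
  qed
  then show ?thesis
    using x(1) t by (simp add: quotientI matrix_ball_add)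
qed

text \<open>Translation by \<open>t\<close> permutes the cosets.  It need not respect the chosen representatives, which
  is where periodicity enters.\<close>

lemma coset_sum_translate:
  assumes \<Phi>: "matrix_ball_periodic n \<epsilon> \<Phi>" and t: "t \<in> matrix_ball n R" and \<epsilon>: "0 \<le> \<epsilon>"
  shows "coset_sum n R \<epsilon> (\<lambda>x. \<Phi> (x + t)) = coset_sum n R \<epsilon> \<Phi>"
  unfolding coset_sum_def
proof (rule sum.reindex_bij_witness[where i = "(`) ((+) (- t))" and j = "(`) ((+) t)"])
  fix C assume C: "C \<in> matrix_ball n R // matrix_ball_rel n R \<epsilon>"
  show "(+) t ` C \<in> matrix_ball n R // matrix_ball_rel n R \<epsilon>" "(+) (- t) ` C \<in> matrix_ball n R // matrix_ball_rel n R \<epsilon>"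
    using translate_coset[OF C] t matrix_ball_minus by blast+
  show "(+) (- t) ` (+) t ` C = C" "(+) t ` (+) (- t) ` C = C"
    by (simp_all add: image_image flip: add.assoc)
  have "(SOME x. x \<in> C) + t \<in> (+) t ` C"
    using some_in_coset[OF \<epsilon> C] by (simp add: add.commute)
  moreover have tC: "(+) t ` C \<in> matrix_ball n R // matrix_ball_rel n R \<epsilon>"
    using C t by (rule translate_coset)
  ultimately show "\<Phi> (SOME x. x \<in> (+) t ` C) = \<Phi> ((SOME x. x \<in> C) + t)"
    using matrix_ball_periodic_coset[OF \<Phi> tC \<epsilon>] some_in_coset[OF \<epsilon> tC] by blast
qed

lemma coset_sum_add:
  "coset_sum n R \<epsilon> (\<lambda>x. \<Phi> x + \<Psi> x) = coset_sum n R \<epsilon> \<Phi> + coset_sum n R \<epsilon> \<Psi>"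
  by (simp add: coset_sum_def sum.distrib)

lemma coset_sum_diff:
  fixes \<Phi> :: "_ \<Rightarrow> 'x::ab_group_add"
  shows "coset_sum n R \<epsilon> (\<lambda>x. \<Phi> x - \<Psi> x) = coset_sum n R \<epsilon> \<Phi> - coset_sum n R \<epsilon> \<Psi>"
  by (simp add: coset_sum_def sum_subtractf)

lemma coset_sum_scale:
  "coset_sum n R \<epsilon> (\<lambda>x. c *\<^sub>C \<Phi> x) = c *\<^sub>C coset_sum n R \<epsilon> \<Phi>"
  by (simp add: coset_sum_def cvec.scale_sum_right)

text \<open>No cancellation can occur in a sum of copies of one vector.\<close>

lemma coset_sum_nonzero:
  fixes \<Phi> :: "_ \<Rightarrow> 'x::complex_vector"
  assumes cover: "finitely_covered_balls av" and \<Phi>: "matrix_ball_periodic n \<epsilon> \<Phi>" and \<epsilon>: "0 < \<epsilon>"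
    and R: "0 \<le> R" and "\<Phi> 0 \<noteq> 0" and values01: "\<And>x. \<Phi> x = \<Phi> 0 \<or> \<Phi> x = 0"
  shows "coset_sum n R \<epsilon> \<Phi> \<noteq> 0"
proof -
  let ?Q = "matrix_ball n R // matrix_ball_rel n R \<epsilon>"
  define A where "A = {C \<in> ?Q. \<Phi> (SOME x. x \<in> C) = \<Phi> 0}"
  have fin: "finite ?Q"
    using cover \<epsilon> by (rule finite_matrix_ball_quotient)
  have C0: "matrix_ball_rel n R \<epsilon> `` {0} \<in> ?Q"
    using zero_in_matrix_ball[OF R] by (rule quotientI)
  have zero: "0 \<in> matrix_ball_rel n R \<epsilon> `` {0}"
    using zero_in_matrix_ball[OF R] zero_in_matrix_ball[of \<epsilon> n] \<epsilon> by (simp add: matrix_ball_rel_def)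
  have "\<Phi> (SOME x. x \<in> matrix_ball_rel n R \<epsilon> `` {0}) = \<Phi> 0"
    by (rule matrix_ball_periodic_coset[OF \<Phi> C0 _ some_in_coset[OF _ C0] zero]) (use \<epsilon> in simp_all)
  with C0 have "matrix_ball_rel n R \<epsilon> `` {0} \<in> A"
    unfolding A_def by blast
  then have card: "card A \<noteq> 0"
    using fin by (auto simp: A_def)
  have "coset_sum n R \<epsilon> \<Phi> = (\<Sum>C\<in>A. \<Phi> (SOME x. x \<in> C))"
    unfolding coset_sum_def A_def using values01 by (intro sum.mono_neutral_right fin) auto
  also have "\<dots> = (\<Sum>C\<in>A. 1 *\<^sub>C \<Phi> 0)"
    by (intro sum.cong) (auto simp: A_def)
  also have "\<dots> = (\<Sum>C\<in>A. 1) *\<^sub>C \<Phi> 0"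
    by (simp only: cvec.scale_sum_left)
  also have "\<dots> \<noteq> 0"
    using card assms(5) by simp
  finally show ?thesis .
qed

end

lemma right_translate_upper_unipotent:
  fixes g :: "'f::field mat"
  assumes g: "g \<in> GL (2 * n)"
  shows "f (g * upper_unipotent n (x + t)) =
    right_translation (2 * n) (upper_unipotent n t) f (g * upper_unipotent n x)"
proof -
  have "g * upper_unipotent n x \<in> GL (2 * n)"
    using g upper_unipotent_in_GL by (rule mult_in_GL)
  moreover have "g * upper_unipotent n (x + t) = g * upper_unipotent n x * upper_unipotent n t"
    unfolding upper_unipotent_add
    by (rule assoc_mult_mat[OF GL_carrier[OF g] upper_unipotent_carrier upper_unipotent_carrier, symmetric])
  ultimately show ?thesis
    by (simp add: right_translation_def)
qed

context ultrametric_field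
begin

text \<open>Smoothness of \<open>f\<close> and continuity of \<open>\<psi>\<^sub>0\<close>, restricted to \<open>N\<close>.\<close>

lemma twisted_translate_periodic:
  fixes l :: "'x::zero \<Rightarrow> 'y::complex_vector"
  assumes \<psi>: "nontrivial_additive_character av \<psi>\<^sub>0" and g: "g \<in> GL (2 * n)"
    and f: "smooth_vector av (2 * n) (right_translation (2 * n)) f" "\<And>x. x \<notin> GL (2 * n) \<Longrightarrow> f x = 0"
  obtains \<epsilon>\<^sub>0 where "0 < \<epsilon>\<^sub>0" "\<And>\<epsilon>. 0 < \<epsilon> \<Longrightarrow> \<epsilon> \<le> \<epsilon>\<^sub>0 \<Longrightarrow>
    matrix_ball_periodic n \<epsilon> (\<lambda>x. \<psi>\<^sub>0 (- index_trace n x) *\<^sub>C l (f (g * upper_unipotent n x)))"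
proof -
  let ?m = "2 * n"
  have \<psi>_add: "\<psi>\<^sub>0 (x + y) = \<psi>\<^sub>0 x * \<psi>\<^sub>0 y" for x y
    using \<psi> by (simp only: nontrivial_additive_character_def)
  obtain \<delta> where \<delta>: "0 < \<delta>" "\<And>x. av x \<le> \<delta> \<Longrightarrow> \<psi>\<^sub>0 x = 1"
    using additive_character_trivial_on_ball[OF \<psi>] by blast
  have "right_translation ?m (1\<^sub>m ?m) f = f"
  proof
    fix x show "right_translation ?m (1\<^sub>m ?m) f x = f x"
    proof (cases "x \<in> GL ?m")
      case True
      then show ?thesis
        using GL_carrier[OF True] by (simp add: right_translation_def)
    next
      case False
      then show ?thesis
        using f(2)[OF False] by (simp add: right_translation_def)
    qed
  qed
  then obtain \<epsilon>1 where \<epsilon>1: "0 < \<epsilon>1" "\<And>k. k \<in> congruence_subgroup ?m \<epsilon>1 \<Longrightarrow> right_translation ?m k f = f"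
    using smooth_vector_nbhd[OF f(1)] by blast
  have "matrix_ball_periodic n \<epsilon> (\<lambda>x. \<psi>\<^sub>0 (- index_trace n x) *\<^sub>C l (f (g * upper_unipotent n x)))"
    if \<epsilon>: "0 < \<epsilon>" "\<epsilon> \<le> min \<epsilon>1 \<delta>" for \<epsilon>
    unfolding matrix_ball_periodic_def
  proof (intro allI ballI)
    fix x s assume s: "s \<in> matrix_ball n \<epsilon>"
    have "upper_unipotent n s \<in> congruence_subgroup ?m \<epsilon>"
      using s \<epsilon> by (intro upper_unipotent_in_congruence_subgroup) auto
    then have "upper_unipotent n s \<in> congruence_subgroup ?m \<epsilon>1"
      using congruence_subgroup_mono[of \<epsilon> \<epsilon>1 ?m] \<epsilon> by auto
    then have fs: "right_translation ?m (upper_unipotent n s) f = f"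
      by (rule \<epsilon>1(2))
    have "f (g * upper_unipotent n (x + s)) = f (g * upper_unipotent n x)"
      unfolding right_translate_upper_unipotent[OF g] fs ..
    moreover have "av (- index_trace n s) \<le> \<delta>"
      using av_index_trace_le[OF s] \<epsilon> by simp
    then have "\<psi>\<^sub>0 (- index_trace n s) = 1"
      by (rule \<delta>(2))
    moreover have "- index_trace n (x + s) = - index_trace n x + (- index_trace n s)"
      by (simp add: index_trace_add)
    ultimately show "\<psi>\<^sub>0 (- index_trace n (x + s)) *\<^sub>C l (f (g * upper_unipotent n (x + s))) =
        \<psi>\<^sub>0 (- index_trace n x) *\<^sub>C l (f (g * upper_unipotent n x))"
      by (simp only: \<psi>_add mult_1_right)
  qed
  then show thesis
    using that[of "min \<epsilon>1 \<delta>"] \<epsilon>1(1) \<delta>(1) by simp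
qed

text \<open>Since \<open>N\<close> is a union of compact subgroups, averaging a vector against \<open>\<psi>\<^sup>-\<^sup>1\<close> over a large
  enough one of them kills any given element of \<open>V(N, \<psi>)\<close>.  The average of a function on the group
  is evaluated at a point \<open>g\<close> here, and then mapped by \<open>l\<close>.\<close>

lemma jacquet_relations_average_0:
  fixes l :: "'x::complex_vector \<Rightarrow> 'y::complex_vector" and V :: "('f mat \<Rightarrow> 'x) set"
  assumes \<psi>: "nontrivial_additive_character av \<psi>\<^sub>0" and l: "clinear l" and g: "g \<in> GL (2 * n)"
    and V: "\<forall>f\<in>V. smooth_vector av (2 * n) (right_translation (2 * n)) f \<and>
      (\<forall>x. x \<notin> GL (2 * n) \<longrightarrow> f x = 0)"
    and d: "d \<in> jacquet_relations \<psi>\<^sub>0 n V (right_translation (2 * n))"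
  shows "\<exists>\<epsilon>\<^sub>0>0. \<exists>R\<^sub>0. \<forall>\<epsilon> R. 0 < \<epsilon> \<and> \<epsilon> \<le> \<epsilon>\<^sub>0 \<and> R\<^sub>0 \<le> R \<longrightarrow>
    coset_sum n R \<epsilon> (\<lambda>x. \<psi>\<^sub>0 (- index_trace n x) *\<^sub>C l (d (g * upper_unipotent n x))) = 0"
proof -
  let ?m = "2 * n"
  define S where "S \<epsilon> R d = coset_sum n R \<epsilon>
      (\<lambda>x. \<psi>\<^sub>0 (- index_trace n x) *\<^sub>C l (d (g * upper_unipotent n x)))" for \<epsilon> R d
  define P where "P d \<longleftrightarrow> (\<exists>\<epsilon>\<^sub>0>0. \<exists>R\<^sub>0. \<forall>\<epsilon> R. 0 < \<epsilon> \<and> \<epsilon> \<le> \<epsilon>\<^sub>0 \<and> R\<^sub>0 \<le> R \<longrightarrow> S \<epsilon> R d = 0)" for d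
  have \<psi>_add: "\<psi>\<^sub>0 (x + y) = \<psi>\<^sub>0 x * \<psi>\<^sub>0 y" for x y
    using \<psi> by (auto simp: nontrivial_additive_character_def)
  have S_add: "S \<epsilon> R (d + d') = S \<epsilon> R d + S \<epsilon> R d'" for \<epsilon> R d d'
    unfolding S_def plus_fun_apply clinear_add[OF l] scaleC_add_right coset_sum_add ..
  have S_scale: "S \<epsilon> R (c *\<^sub>C d) = c *\<^sub>C S \<epsilon> R d" for \<epsilon> R c d
  proof -
    have "S \<epsilon> R (c *\<^sub>C d) = coset_sum n R \<epsilon>
        (\<lambda>x. c *\<^sub>C (\<psi>\<^sub>0 (- index_trace n x) *\<^sub>C l (d (g * upper_unipotent n x))))"
      unfolding S_def
      by (simp add: scaleC_fun_def clinear_scale[OF l] scaleC_scaleC mult.commute)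
    then show ?thesis
      unfolding S_def by (simp only: coset_sum_scale)
  qed
  have "cvec.subspace {d. P d}"
    unfolding cvec.subspace_def mem_Collect_eq
  proof (intro conjI ballI allI)
    have "S \<epsilon> R 0 = 0" for \<epsilon> R
      using S_scale[of \<epsilon> R 0 0] by simp
    then show "P 0"
      unfolding P_def by (intro exI[of _ 1]) simp
  next
    fix d d' assume "d \<in> {d. P d}" "d' \<in> {d. P d}"
    then obtain \<epsilon>1 R1 \<epsilon>2 R2 where
      1: "0 < \<epsilon>1" "\<And>\<epsilon> R. 0 < \<epsilon> \<and> \<epsilon> \<le> \<epsilon>1 \<and> R1 \<le> R \<Longrightarrow> S \<epsilon> R d = 0" and
      2: "0 < \<epsilon>2" "\<And>\<epsilon> R. 0 < \<epsilon> \<and> \<epsilon> \<le> \<epsilon>2 \<and> R2 \<le> R \<Longrightarrow> S \<epsilon> R d' = 0"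
      unfolding P_def mem_Collect_eq by metis
    have "S \<epsilon> R (d + d') = 0" if "0 < \<epsilon> \<and> \<epsilon> \<le> min \<epsilon>1 \<epsilon>2 \<and> max R1 R2 \<le> R" for \<epsilon> R
      using that by (simp add: S_add 1(2) 2(2))
    then show "P (d + d')"
      unfolding P_def using 1(1) 2(1) by (intro exI[of _ "min \<epsilon>1 \<epsilon>2"] conjI exI[of _ "max R1 R2"]) simp_all
  next
    fix c d assume "d \<in> {d. P d}"
    then show "P (c *\<^sub>C d)"
      unfolding P_def mem_Collect_eq S_scale by (metis cvec.scale_zero_right)
  qed
  \<comment> \<open>On a generator, twisting turns the relation into the difference of a periodic function and its
    translate, whose sums over cosets agree.\<close>
  moreover have "P d" if "d \<in> {right_translation ?m (four_block_mat (1\<^sub>m n) X (0\<^sub>m n n) (1\<^sub>m n)) f -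
      \<psi>\<^sub>0 (\<Sum>i<n. X $$ (i, i)) *\<^sub>C f | X f. X \<in> carrier_mat n n \<and> f \<in> V}" for d
  proof -
    obtain X f where X: "X \<in> carrier_mat n n" and f: "f \<in> V"
      and d: "d = right_translation ?m (four_block_mat (1\<^sub>m n) X (0\<^sub>m n n) (1\<^sub>m n)) f -
        \<psi>\<^sub>0 (\<Sum>i<n. X $$ (i, i)) *\<^sub>C f"
      using \<open>d \<in> _\<close> by blast
    define t where "t = (\<lambda>(i, j). if i < n \<and> j < n then X $$ (i, j) else 0)"
    have Xt: "X = Matrix.mat n n t"
      using X by (intro eq_matI) (auto simp: t_def)
    obtain R\<^sub>0 where R0: "0 < R\<^sub>0" "mat_bounded R\<^sub>0 X"
      using mat_bounded_exists .
    then have t: "t \<in> matrix_ball n R\<^sub>0"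
      using X by (intro matrix_ballI) (auto simp: t_def mat_bounded_def)
    have "(\<Sum>i<n. X $$ (i, i)) = index_trace n t"
      unfolding index_trace_def by (intro sum.cong) (auto simp: t_def)
    then have d': "d = right_translation ?m (upper_unipotent n t) f - \<psi>\<^sub>0 (index_trace n t) *\<^sub>C f"
      unfolding d upper_unipotent_def Xt[symmetric] by simp
    define \<Phi> where "\<Phi> x = \<psi>\<^sub>0 (- index_trace n x) *\<^sub>C l (f (g * upper_unipotent n x))" for x
    have fV: "smooth_vector av ?m (right_translation ?m) f" "\<And>x. x \<notin> GL ?m \<Longrightarrow> f x = 0"
      using V f by blast+
    obtain \<epsilon>1 where \<epsilon>1: "0 < \<epsilon>1" "\<And>\<epsilon>. 0 < \<epsilon> \<Longrightarrow> \<epsilon> \<le> \<epsilon>1 \<Longrightarrow> matrix_ball_periodic n \<epsilon> \<Phi>"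
      using twisted_translate_periodic[OF \<psi> g fV, where l = l]
      unfolding \<Phi>_def by blast
    have "S \<epsilon> R d = 0" if \<epsilon>R: "0 < \<epsilon> \<and> \<epsilon> \<le> \<epsilon>1 \<and> R\<^sub>0 \<le> R" for \<epsilon> R
    proof -
      have per: "matrix_ball_periodic n \<epsilon> \<Phi>"
        using \<epsilon>R by (intro \<epsilon>1(2)) auto
      have "\<psi>\<^sub>0 (- index_trace n x) *\<^sub>C l (d (g * upper_unipotent n x)) =
          \<psi>\<^sub>0 (index_trace n t) *\<^sub>C (\<Phi> (x + t) - \<Phi> x)" for x
      proof -
        interpret l: Vector_Spaces.linear scaleC scaleC l by (rule l)
        have "d (g * upper_unipotent n x) =
            f (g * upper_unipotent n (x + t)) - \<psi>\<^sub>0 (index_trace n t) *\<^sub>C f (g * upper_unipotent n x)"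
          by (simp add: d' right_translate_upper_unipotent[OF g] scaleC_fun_def)
        moreover have "\<psi>\<^sub>0 (- index_trace n x) = \<psi>\<^sub>0 (index_trace n t) * \<psi>\<^sub>0 (- index_trace n (x + t))"
          by (simp add: index_trace_add flip: \<psi>_add)
        ultimately show ?thesis
          by (simp add: \<Phi>_def l.diff l.scale cvec.scale_right_diff_distrib scaleC_scaleC mult.commute)
      qed
      then have "S \<epsilon> R d = \<psi>\<^sub>0 (index_trace n t) *\<^sub>C
          (coset_sum n R \<epsilon> (\<lambda>x. \<Phi> (x + t)) - coset_sum n R \<epsilon> \<Phi>)"
        by (simp add: S_def coset_sum_scale coset_sum_diff)
      moreover have "t \<in> matrix_ball n R"
        using t matrix_ball_mono[of R\<^sub>0 R n] \<epsilon>R by auto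
      ultimately show ?thesis
        using coset_sum_translate[OF per] \<epsilon>R by simp
    qed
    then show "P d"
      unfolding P_def using \<epsilon>1(1) by blast
  qed
  ultimately have "P d"
    using cvec.span_induct[OF d[unfolded jacquet_relations_def], of P] by blast
  then show ?thesis
    by (simp add: P_def S_def)
qed

end

section \<open>The contribution of the open orbit\<close>

context ultrametric_field
begin

text \<open>The hypothesis \<open>orbit\<close> says that, seen from \<open>g\<close>, an element of \<open>N\<close> splits into a part in the
  diagonal blocks, on which \<open>l\<close> transforms by a part of \<open>\<psi>\<close>, and a part \<open>Y\<close> transversal to the
  parabolic subgroup that accounts for the rest of \<open>\<psi>\<close>.  Translate the function supported near the
  parabolic subgroup by \<open>g\<close>: its average against \<open>\<psi>\<^sup>-\<^sup>1\<close> over any compact subgroup of \<open>N\<close> only sees small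
  \<open>Y\<close>, where all characters cancel and the integrand is the constant \<open>l (v \<otimes> w)\<close>.  The average does
  not vanish, so the function is not in \<open>V(N, \<psi>)\<close>.\<close>

lemma twisted_jacquet_nonzero_from_orbit:
  fixes l :: "('v::complex_vector, 'w::complex_vector) tensor \<Rightarrow> 'y::complex_vector"
  assumes cover: "finitely_covered_balls av" and \<psi>: "nontrivial_additive_character av \<psi>\<^sub>0"
    and \<sigma>: "smooth_rep av a \<sigma>" and \<tau>: "smooth_rep av b \<tau>" and ab: "a + b = 2 * n"
    and g: "g \<in> GL (2 * n)" "g' \<in> GL (2 * n)" "g * g' = 1\<^sub>m (2 * n)"
    and l: "clinear l" "l (v \<otimes>\<^sub>C w) \<noteq> 0"
    and orbit: "\<And>x. \<exists>u\<^sub>1\<in>GL a. \<exists>u\<^sub>2\<in>GL b. \<exists>Y\<in>carrier_mat b a. \<exists>s.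
      det u\<^sub>1 = 1 \<and> det u\<^sub>2 = 1 \<and>
      g * upper_unipotent n x * g' = cell_point u\<^sub>1 (0\<^sub>m a b) u\<^sub>2 Y \<and>
      l (\<sigma> u\<^sub>1 v \<otimes>\<^sub>C \<tau> u\<^sub>2 w) = \<psi>\<^sub>0 s *\<^sub>C l (v \<otimes>\<^sub>C w) \<and>
      (\<forall>\<epsilon>\<ge>0. mat_bounded \<epsilon> Y \<longrightarrow> av (index_trace n x - s) \<le> \<epsilon>)"
  shows "twisted_jacquet_nonzero \<psi>\<^sub>0 n (induced_space av a b \<sigma> \<tau>) (right_translation (2 * n))"
proof -
  let ?m = "2 * n"
  let ?V = "induced_space av a b \<sigma> \<tau>"
  let ?J = "jacquet_relations \<psi>\<^sub>0 n ?V (right_translation ?m)"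
  have \<psi>_add: "\<psi>\<^sub>0 (x + y) = \<psi>\<^sub>0 x * \<psi>\<^sub>0 y" for x y
    using \<psi> by (simp only: nontrivial_additive_character_def)
  obtain \<epsilon>v where \<epsilon>v: "0 < \<epsilon>v" "\<epsilon>v < 1" "\<And>k. k \<in> congruence_subgroup a \<epsilon>v \<Longrightarrow> \<sigma> k v = v"
    using smooth_vector_nbhd[of a \<sigma> v] \<sigma> unfolding smooth_rep_def by blast
  obtain \<epsilon>w where \<epsilon>w: "0 < \<epsilon>w" "\<epsilon>w < 1" "\<And>k. k \<in> congruence_subgroup b \<epsilon>w \<Longrightarrow> \<tau> k w = w"
    using smooth_vector_nbhd[of b \<tau> w] \<tau> unfolding smooth_rep_def by blast
  obtain \<delta> where \<delta>: "0 < \<delta>" "\<And>x. av x \<le> \<delta> \<Longrightarrow> \<psi>\<^sub>0 x = 1"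
    using additive_character_trivial_on_ball[OF \<psi>] by blast
  define \<epsilon> where "\<epsilon> = min \<delta> (min \<epsilon>v \<epsilon>w)"
  have \<epsilon>: "0 < \<epsilon>" "\<epsilon> < 1" "\<epsilon> \<le> \<delta>" "\<epsilon> \<le> \<epsilon>v" "\<epsilon> \<le> \<epsilon>w"
    using \<epsilon>v \<epsilon>w \<delta> by (auto simp: \<epsilon>_def)
  have fixed: "\<And>k. k \<in> congruence_subgroup a \<epsilon> \<Longrightarrow> \<sigma> k v = v"
      "\<And>k. k \<in> congruence_subgroup b \<epsilon> \<Longrightarrow> \<tau> k w = w"
    using \<epsilon>v(3) \<epsilon>w(3) congruence_subgroup_mono \<epsilon>(4,5) by blast+
  define h where "h = bump a b \<sigma> \<tau> \<epsilon> v w"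
  define f where "f = right_translation ?m g' h"
  have fV: "f \<in> ?V"
    using right_translation_bump_in_induced_space[OF \<sigma> \<tau> fixed \<epsilon>(1,2)] g(2)
    by (simp add: f_def h_def flip: ab)
  have V: "smooth_vector av ?m (right_translation ?m) d" "x \<notin> GL ?m \<Longrightarrow> d x = 0" if "d \<in> ?V" for d x
    using that by (simp_all add: induced_space_def ab)
  then have V': "\<forall>d\<in>?V. smooth_vector av ?m (right_translation ?m) d \<and> (\<forall>x. x \<notin> GL ?m \<longrightarrow> d x = 0)"
    by blast
  define z where "z = l (v \<otimes>\<^sub>C w)"
  define \<Phi> where "\<Phi> x = \<psi>\<^sub>0 (- index_trace n x) *\<^sub>C l (f (g * upper_unipotent n x))" for x
  have f_eq: "f (g * upper_unipotent n x) = h (g * upper_unipotent n x * g')" for x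
    using mult_in_GL[OF g(1) upper_unipotent_in_GL] by (simp add: f_def right_translation_def)
  have h_cell: "h y = \<sigma> u\<^sub>1 v \<otimes>\<^sub>C \<tau> u\<^sub>2 w"
    if "in_cell a b \<epsilon> y u\<^sub>1 u\<^sub>2" "det u\<^sub>1 = 1" "det u\<^sub>2 = 1" for y u\<^sub>1 u\<^sub>2
    unfolding h_def bump_def cell_function_eq[OF that(1)]
    by (simp add: modulus_def that(2,3) scaleC_one)
  have \<Phi>_values: "\<Phi> x = z \<or> \<Phi> x = 0" for x
  proof -
    obtain u\<^sub>1 u\<^sub>2 Y s where u: "u\<^sub>1 \<in> GL a" "u\<^sub>2 \<in> GL b" "Y \<in> carrier_mat b a"
        "det u\<^sub>1 = 1" "det u\<^sub>2 = 1" "g * upper_unipotent n x * g' = cell_point u\<^sub>1 (0\<^sub>m a b) u\<^sub>2 Y"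
        "l (\<sigma> u\<^sub>1 v \<otimes>\<^sub>C \<tau> u\<^sub>2 w) = \<psi>\<^sub>0 s *\<^sub>C z"
        "\<forall>\<epsilon>\<ge>0. mat_bounded \<epsilon> Y \<longrightarrow> av (index_trace n x - s) \<le> \<epsilon>"
      using orbit[of x] unfolding z_def by blast
    show ?thesis
    proof (cases "mat_bounded \<epsilon> Y")
      case True
      have "in_cell a b \<epsilon> (cell_point u\<^sub>1 (0\<^sub>m a b) u\<^sub>2 Y) u\<^sub>1 u\<^sub>2"
        unfolding in_cell_def using u(1,2,3) True zero_carrier_mat by blast
      then have "l (f (g * upper_unipotent n x)) = \<psi>\<^sub>0 s *\<^sub>C z"
        unfolding f_eq u(6) using h_cell u(4,5,7) by simp
      moreover have "av (index_trace n x - s) \<le> \<epsilon>"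
        using u(8) True less_imp_le[OF \<epsilon>(1)] by blast
      then have "av (- index_trace n x + s) \<le> \<delta>"
        using \<epsilon>(3) av_minus[of "index_trace n x - s"] by simp
      then have "\<psi>\<^sub>0 (- index_trace n x) * \<psi>\<^sub>0 s = 1"
        unfolding \<psi>_add[symmetric] by (rule \<delta>(2))
      ultimately have "\<Phi> x = z"
        by (simp add: \<Phi>_def scaleC_scaleC scaleC_one)
      then show ?thesis ..
    next
      case False
      have "\<not> in_cell a b \<epsilon> (cell_point u\<^sub>1 (0\<^sub>m a b) u\<^sub>2 Y) g\<^sub>1 g\<^sub>2" for g\<^sub>1 g\<^sub>2
      proof
        assume "in_cell a b \<epsilon> (cell_point u\<^sub>1 (0\<^sub>m a b) u\<^sub>2 Y) g\<^sub>1 g\<^sub>2"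
        then obtain z' Y' where *: "g\<^sub>1 \<in> GL a" "g\<^sub>2 \<in> GL b" "z' \<in> carrier_mat a b" "Y' \<in> carrier_mat b a"
            "mat_bounded \<epsilon> Y'" "cell_point u\<^sub>1 (0\<^sub>m a b) u\<^sub>2 Y = cell_point g\<^sub>1 z' g\<^sub>2 Y'"
          unfolding in_cell_def by blast
        have "Y = Y'"
          by (rule cell_point_inject(4)[OF *(6) GL_carrier[OF u(1)] zero_carrier_mat u(2,3)
                GL_carrier[OF *(1)] *(3,2,4)])
        with False *(5) show False by simp
      qed
      then have "f (g * upper_unipotent n x) = 0"
        unfolding f_eq u(6) h_def bump_def by (rule cell_function_eq_0)
      moreover have "l 0 = 0"
        using clinear_scale[OF l(1), of 0 0] by simp
      ultimately have "\<Phi> x = 0"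
        by (simp add: \<Phi>_def)
      then show ?thesis ..
    qed
  qed
  have \<Phi>_0: "\<Phi> 0 = z"
  proof -
    have "cell_point (1\<^sub>m a) (0\<^sub>m a b) (1\<^sub>m b) (0\<^sub>m b a) = 1\<^sub>m ?m"
      by (simp add: cell_point_def flip: ab)
    then have "in_cell a b \<epsilon> (1\<^sub>m ?m) (1\<^sub>m a) (1\<^sub>m b)"
      unfolding in_cell_def using mat_bounded_zero[OF less_imp_le[OF \<epsilon>(1)], of b a]
      by (metis one_in_GL zero_carrier_mat)
    then have "h (1\<^sub>m ?m) = v \<otimes>\<^sub>C w"
      using h_cell[of "1\<^sub>m ?m" "1\<^sub>m a" "1\<^sub>m b"] \<sigma> \<tau> by (simp add: smooth_rep_def)
    moreover have "g * upper_unipotent n 0 * g' = 1\<^sub>m ?m"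
      using GL_carrier[OF g(1)] g(3) by (simp add: upper_unipotent_0)
    moreover have "index_trace n (0 :: nat \<times> nat \<Rightarrow> 'f) = 0"
      by (simp add: index_trace_def)
    ultimately show ?thesis
      using \<delta>(2)[of 0] \<delta>(1) by (simp add: \<Phi>_def f_eq z_def scaleC_one)
  qed
  have fJ: "f \<notin> ?J"
  proof
    assume fJ: "f \<in> ?J"
    obtain \<epsilon>0 R0 where avg: "0 < \<epsilon>0"
        "\<And>e R. 0 < e \<and> e \<le> \<epsilon>0 \<and> R0 \<le> R \<Longrightarrow> coset_sum n R e \<Phi> = 0"
      using jacquet_relations_average_0[OF \<psi> l(1) g(1) V' fJ] unfolding \<Phi>_def by blast
    obtain \<epsilon>1 where per: "0 < \<epsilon>1" "\<And>e. 0 < e \<Longrightarrow> e \<le> \<epsilon>1 \<Longrightarrow> matrix_ball_periodic n e \<Phi>"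
      using twisted_translate_periodic[OF \<psi> g(1) V(1)[OF fV] V(2)[OF fV], where l = l]
      unfolding \<Phi>_def by blast
    define e where "e = min \<epsilon>0 \<epsilon>1"
    have e: "0 < e" "e \<le> \<epsilon>0" "e \<le> \<epsilon>1"
      using avg(1) per(1) by (auto simp: e_def)
    have "\<Phi> 0 \<noteq> 0"
      using l(2) by (simp add: \<Phi>_0 z_def)
    then have "coset_sum n (max R0 0) e \<Phi> \<noteq> 0"
      using \<Phi>_values e unfolding \<Phi>_0[symmetric]
      by (intro coset_sum_nonzero[OF cover per(2)]) auto
    moreover have "coset_sum n (max R0 0) e \<Phi> = 0"
      using e by (intro avg(2)) auto
    ultimately show False by simp
  qed
  have "f + 0 \<in> (+) f ` ?J"
    unfolding jacquet_relations_def by (intro imageI cvec.span_zero)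
  with fJ have "(+) f ` ?J \<noteq> ?J" by auto
  then show ?thesis
    unfolding twisted_jacquet_nonzero_def twisted_jacquet_def using fV by blast
qed

end

lemma permutation_matrix_conjugation:
  fixes p :: "nat \<Rightarrow> nat"
  assumes p: "inj_on p {..<m}" "p ` {..<m} \<subseteq> {..<m}"
  obtains g g' :: "'f::field mat" where "g \<in> GL m" "g' \<in> GL m" "g * g' = 1\<^sub>m m"
    "\<And>M. M \<in> carrier_mat m m \<Longrightarrow> g * M * g' = Matrix.mat m m (\<lambda>(i, j). M $$ (p i, p j))"
proof -
  define g where "g = Matrix.mat m m (\<lambda>(i, j). if j = p i then 1 else (0::'f))"
  define g' where "g' = Matrix.mat m m (\<lambda>(i, j). if i = p j then 1 else (0::'f))"
  have c: "g \<in> carrier_mat m m" "g' \<in> carrier_mat m m"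
    by (simp_all add: g_def g'_def)
  have pm: "p i < m" if "i < m" for i
    using p(2) that by auto
  have left: "(g * M) $$ (i, j) = M $$ (p i, j)" if "M \<in> carrier_mat m m" "i < m" "j < m" for M i j
  proof -
    have "(g * M) $$ (i, j) = (\<Sum>k = 0..<m. (if k = p i then 1 else 0) * M $$ (k, j))"
      using that c by (simp add: scalar_prod_def) (simp add: g_def)
    also have "\<dots> = (\<Sum>k = 0..<m. if k = p i then M $$ (k, j) else 0)"
      by (intro sum.cong) auto
    finally show ?thesis
      using pm[OF that(2)] by (simp add: sum.delta)
  qed
  have right: "(M * g') $$ (i, j) = M $$ (i, p j)" if "M \<in> carrier_mat m m" "i < m" "j < m" for M i j
  proof -
    have "(M * g') $$ (i, j) = (\<Sum>k = 0..<m. M $$ (i, k) * (if k = p j then 1 else 0))"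
      using that c by (simp add: scalar_prod_def) (simp add: g'_def)
    also have "\<dots> = (\<Sum>k = 0..<m. if k = p j then M $$ (i, k) else 0)"
      by (intro sum.cong) auto
    finally show ?thesis
      using pm[OF that(3)] by (simp add: sum.delta)
  qed
  have conj: "g * M * g' = Matrix.mat m m (\<lambda>(i, j). M $$ (p i, p j))" if M: "M \<in> carrier_mat m m" for M
  proof (intro eq_matI)
    fix i j assume "i < dim_row (Matrix.mat m m (\<lambda>(i, j). M $$ (p i, p j)))"
      "j < dim_col (Matrix.mat m m (\<lambda>(i, j). M $$ (p i, p j)))"
    then have ij: "i < m" "j < m" by auto
    then have "(g * M * g') $$ (i, j) = M $$ (p i, p j)"
      using right[of "g * M" i j] left[OF M, of i "p j"] pm c M by simp
    then show "(g * M * g') $$ (i, j) = Matrix.mat m m (\<lambda>(i, j). M $$ (p i, p j)) $$ (i, j)"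
      using ij by simp
  qed (use c in auto)
  have inv: "g * g' = 1\<^sub>m m"
  proof (intro eq_matI)
    fix i j assume "i < dim_row (1\<^sub>m m :: 'f mat)" "j < dim_col (1\<^sub>m m :: 'f mat)"
    then have ij: "i < m" "j < m" by auto
    have "(g * g') $$ (i, j) = (if p i = p j then 1 else 0)"
      using left[OF c(2) ij] ij pm by (simp add: g'_def)
    then show "(g * g') $$ (i, j) = 1\<^sub>m m $$ (i, j)"
      using ij p(1) by (auto simp: inj_on_def)
  qed (use c in auto)
  have "g' \<in> GL m"
    using c mat_mult_left_right_inverse[OF c inv] by (intro GL_I[of _ _ g])
  moreover have "g \<in> GL m"
    using c inv by (intro GL_I[of _ _ g'])
  ultimately show thesis
    using that inv conj by blast
qed

lemma unipotent_upper_det: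
  fixes u :: "'f::field mat"
  assumes "u \<in> unipotent_upper m"
  shows "det u = 1" "u \<in> GL m"
proof -
  have u: "u \<in> carrier_mat m m" "upper_triangular u" "\<forall>i<m. u $$ (i, i) = 1"
    using assms by (auto simp: unipotent_upper_def)
  have "diag_mat u = map (\<lambda>i. 1) [0..<m]"
    unfolding diag_mat_def using u(1,3) by (intro map_cong) auto
  then show "det u = 1"
    using det_upper_triangular[OF u(2,1)] by (simp add: map_replicate_const)
  then show "u \<in> GL m"
    using u(1) by (intro det_nonzero_in_GL) auto
qed

lemma upper_unipotent_entry:
  assumes "i < 2 * n" "j < 2 * n"
  shows "upper_unipotent n x $$ (i, j) =
    (if i < n \<and> n \<le> j then x (i, j - n) else if i = j then 1 else 0)"
  using assms by (auto simp: upper_unipotent_def)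

lemma whittaker_functional_exists:
  assumes "generic \<psi>\<^sub>0 m \<pi>"
  obtains l v where "l \<in> whittaker_functionals \<psi>\<^sub>0 m \<pi>" "l v \<noteq> 0"
proof -
  have "0 \<in> whittaker_functionals \<psi>\<^sub>0 m \<pi>"
    by (auto simp: whittaker_functionals_def scaleC_complex_def intro!: clinearI)
  then obtain l where l: "l \<in> whittaker_functionals \<psi>\<^sub>0 m \<pi>" "l \<noteq> 0"
    using assms unfolding generic_def by blast
  then obtain v where "l v \<noteq> 0"
    by (auto simp: fun_eq_iff)
  with l(1) show thesis by (rule that)
qed

lemma bilinear_scale:
  fixes l :: "'v::complex_vector \<Rightarrow> complex"
  assumes "clinear l"
  shows "cbilinear (\<lambda>v (w :: 'w::complex_vector). l v *\<^sub>C w)"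
    and "cbilinear (\<lambda>(w :: 'w::complex_vector) v. l v *\<^sub>C w)"
  unfolding cbilinear_def
  by (auto intro!: clinearI simp: clinear_add[OF assms] clinear_scale[OF assms] scaleC_add_right
      scaleC_add_left scaleC_scaleC scaleC_complex_def mult.commute)

context ultrametric_field
begin

text \<open>With \<open>W\<close> the span of the last \<open>n - 1\<close> rows, the chosen permutation matrix \<open>g\<close> has the rows
  \<open>e\<^sub>0\<close>, then \<open>e\<^sub>n, \<dots>, e\<^sub>2\<^sub>n\<^sub>-\<^sub>1\<close>, then \<open>e\<^sub>1, \<dots>, e\<^sub>n\<^sub>-\<^sub>1\<close>.  So \<open>W g\<close> meets the last \<open>n\<close>
  coordinates trivially, which is the generic position.  Conjugation by \<open>g\<close> moves row \<open>0\<close> of \<open>x\<close> into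
  a unipotent element of \<open>GL (n + 1)\<close>, on which the Whittaker character is \<open>\<psi>\<^sub>0 (x\<^sub>0\<^sub>0)\<close>; the other
  rows of \<open>x\<close> end up below the diagonal blocks and carry the rest of the trace.\<close>

lemma twisted_jacquet_nonzero_generic_first:
  fixes \<rho> :: "'f mat \<Rightarrow> 'v::complex_vector \<Rightarrow> 'v" and \<eta> :: "'f mat \<Rightarrow> 'w::complex_vector \<Rightarrow> 'w"
  assumes cover: "finitely_covered_balls av" and \<psi>: "nontrivial_additive_character av \<psi>\<^sub>0"
    and n: "1 \<le> n" and \<rho>: "smooth_rep av (n + 1) \<rho>" "generic \<psi>\<^sub>0 (n + 1) \<rho>"
    and \<eta>: "smooth_rep av (n - 1) \<eta>" and w: "w \<noteq> (0::'w)"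
  shows "twisted_jacquet_nonzero \<psi>\<^sub>0 n (induced_space av (n + 1) (n - 1) \<rho> \<eta>) (right_translation (2 * n))"
proof -
  obtain wh v where wh: "wh \<in> whittaker_functionals \<psi>\<^sub>0 (n + 1) \<rho>" "wh v \<noteq> 0"
    using whittaker_functional_exists[OF \<rho>(2)] .
  have lin: "clinear wh"
    using wh(1) by (simp add: whittaker_functionals_def)
  \<comment> \<open>Keeping the space of \<open>\<eta>\<close> as the target spares the choice of a functional on \<open>\<eta>\<close>.\<close>
  define l :: "('v, 'w) tensor \<Rightarrow> 'w" where "l = tensor_lift (\<lambda>v w. wh v *\<^sub>C w)"
  have l: "clinear l" and l_tensor: "l (v' \<otimes>\<^sub>C w') = wh v' *\<^sub>C w'" for v' w'
    using bilinear_scale(1)[OF lin, where 'w = 'w] by (simp_all add: l_def clinear_tensor_lift tensor_lift_tensor)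
  define p where "p i = (if i = 0 then 0 else if i \<le> n then n + i - 1 else i - n)" for i
  have "inj_on p {..<2 * n}"
    unfolding inj_on_def p_def using n by (auto split: if_splits)
  moreover have "p ` {..<2 * n} \<subseteq> {..<2 * n}"
    unfolding p_def using n by auto
  ultimately obtain g g' :: "'f mat" where g: "g \<in> GL (2 * n)" "g' \<in> GL (2 * n)" "g * g' = 1\<^sub>m (2 * n)"
    and conj: "\<And>M. M \<in> carrier_mat (2 * n) (2 * n) \<Longrightarrow>
      g * M * g' = Matrix.mat (2 * n) (2 * n) (\<lambda>(i, j). M $$ (p i, p j))"
    using permutation_matrix_conjugation[of p "2 * n"] by metis
  show ?thesis
  proof (rule twisted_jacquet_nonzero_from_orbit[OF cover \<psi> \<rho>(1) \<eta> _ g l, where v = v and w = w])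
    show "n + 1 + (n - 1) = 2 * n" using n by simp
    show "l (v \<otimes>\<^sub>C w) \<noteq> 0"
      using wh(2) w by (simp add: l_tensor)
    fix x :: "nat \<times> nat \<Rightarrow> 'f"
    define u where "u = Matrix.mat (n + 1) (n + 1)
      (\<lambda>(i, j). if i = j then 1 else if i = 0 then x (0, j - 1) else 0)"
    define Y where "Y = Matrix.mat (n - 1) (n + 1) (\<lambda>(i, j). if j = 0 then 0 else x (i + 1, j - 1))"
    have u: "u \<in> unipotent_upper (n + 1)"
      by (auto simp: unipotent_upper_def u_def)
    have uc: "u \<in> carrier_mat (n + 1) (n + 1)" and Yc: "Y \<in> carrier_mat (n - 1) (n + 1)"
      by (simp_all add: u_def Y_def)
    have "(\<Sum>i<n + 1 - 1. u $$ (i, i + 1)) = (\<Sum>i<n. if i = 0 then x (0, 0) else 0)"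
      by (intro sum.cong) (auto simp: u_def)
    also have "\<dots> = x (0, 0)"
      using n by (simp add: sum.delta)
    finally have "wh (\<rho> u v) = \<psi>\<^sub>0 (x (0, 0)) * wh v"
      using wh(1) u by (simp add: whittaker_functionals_def whittaker_character_def)
    moreover have "\<eta> (1\<^sub>m (n - 1)) w = w"
      using \<eta> by (simp add: smooth_rep_def)
    ultimately have l_u: "l (\<rho> u v \<otimes>\<^sub>C \<eta> (1\<^sub>m (n - 1)) w) = \<psi>\<^sub>0 (x (0, 0)) *\<^sub>C l (v \<otimes>\<^sub>C w)"
      by (simp add: l_tensor scaleC_scaleC)
    have "g * upper_unipotent n x * g' = four_block_mat u (0\<^sub>m (n + 1) (n - 1)) Y (1\<^sub>m (n - 1))"
      unfolding conj[OF upper_unipotent_carrier]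
    proof (intro eq_matI)
      let ?B = "four_block_mat u (0\<^sub>m (n + 1) (n - 1)) Y (1\<^sub>m (n - 1))"
      fix i j assume "i < dim_row ?B" "j < dim_col ?B"
      then have ij: "i < 2 * n" "j < 2 * n"
        using uc n by auto
      then have pij: "p i < 2 * n" "p j < 2 * n"
        using n by (auto simp: p_def)
      obtain m where m: "n = Suc m"
        using n by (cases n) auto
      have split: "i = 0 \<or> (\<exists>k<n. i = Suc k) \<or> (\<exists>k<m. i = n + 1 + k)" if "i < 2 * n" for i
        using that m by presburger
      have "?B $$ (i, j) = (if p i < n \<and> n \<le> p j then x (p i, p j - n) else if p i = p j then 1 else 0)"
        using split[OF ij(1)] split[OF ij(2)]
        by (elim disjE exE conjE) (simp_all add: p_def u_def Y_def m)
      moreover have "Matrix.mat (2 * n) (2 * n) (\<lambda>(i, j). upper_unipotent n x $$ (p i, p j)) $$ (i, j) =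
          upper_unipotent n x $$ (p i, p j)"
        using ij by simp
      ultimately show "Matrix.mat (2 * n) (2 * n) (\<lambda>(i, j). upper_unipotent n x $$ (p i, p j)) $$ (i, j) = ?B $$ (i, j)"
        by (simp only: upper_unipotent_entry[OF pij])
    qed (use uc n in auto)
    also have "\<dots> = cell_point u (0\<^sub>m (n + 1) (n - 1)) (1\<^sub>m (n - 1)) Y"
      unfolding cell_point_def using uc Yc by simp
    finally have eq: "g * upper_unipotent n x * g' = cell_point u (0\<^sub>m (n + 1) (n - 1)) (1\<^sub>m (n - 1)) Y" .
    have trace: "av (index_trace n x - x (0, 0)) \<le> \<epsilon>" if \<epsilon>: "0 \<le> \<epsilon>" "mat_bounded \<epsilon> Y" for \<epsilon>
    proof -
      have trace_eq: "index_trace n x - x (0, 0) = (\<Sum>i\<in>{..<n} - {0}. x (i, i))"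
        using n by (simp add: index_trace_def sum_diff1)
      have entries: "av (x (i, i)) \<le> \<epsilon>" if i: "i \<in> {..<n} - {0}" for i
      proof -
        obtain k where k: "i = Suc k" "k < n - 1"
          using i by (cases i) auto
        then have "av (Y $$ (k, k + 2)) \<le> \<epsilon>"
          using \<epsilon>(2) Yc by (auto simp: mat_bounded_def)
        then show ?thesis
          using k by (simp add: Y_def)
      qed
      show ?thesis
        unfolding trace_eq by (rule av_sum_le[OF \<epsilon>(1) entries])
    qed
    show "\<exists>u\<^sub>1\<in>GL (n + 1). \<exists>u\<^sub>2\<in>GL (n - 1). \<exists>Y\<in>carrier_mat (n - 1) (n + 1). \<exists>s.
      det u\<^sub>1 = 1 \<and> det u\<^sub>2 = 1 \<and>
      g * upper_unipotent n x * g' = cell_point u\<^sub>1 (0\<^sub>m (n + 1) (n - 1)) u\<^sub>2 Y \<and>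
      l (\<rho> u\<^sub>1 v \<otimes>\<^sub>C \<eta> u\<^sub>2 w) = \<psi>\<^sub>0 s *\<^sub>C l (v \<otimes>\<^sub>C w) \<and>
      (\<forall>\<epsilon>\<ge>0. mat_bounded \<epsilon> Y \<longrightarrow> av (index_trace n x - s) \<le> \<epsilon>)"
      using unipotent_upper_det[OF u] Yc eq l_u trace
      by (intro bexI[of _ u] bexI[of _ "1\<^sub>m (n - 1)"] bexI[of _ Y] exI[of _ "x (0, 0)"] conjI allI impI)
        (simp_all only: det_one one_in_GL)
  qed
qed

text \<open>Now \<open>\<rho>\<close> lives on the span of the last \<open>n + 1\<close> rows, and a subspace of this dimension must meet
  the last \<open>n\<close> coordinates.  The rows of \<open>g\<close> are \<open>e\<^sub>n, \<dots>, e\<^sub>2\<^sub>n\<^sub>-\<^sub>2\<close>, then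
  \<open>e\<^sub>0, \<dots>, e\<^sub>n\<^sub>-\<^sub>1, e\<^sub>2\<^sub>n\<^sub>-\<^sub>1\<close>, so that the intersection is a line.  It is the last column
  of \<open>x\<close> that enters the unipotent element of \<open>GL (n + 1)\<close>, whose Whittaker character is that of the
  last diagonal entry.\<close>

lemma twisted_jacquet_nonzero_generic_second:
  fixes \<rho> :: "'f mat \<Rightarrow> 'v::complex_vector \<Rightarrow> 'v" and \<eta> :: "'f mat \<Rightarrow> 'w::complex_vector \<Rightarrow> 'w"
  assumes cover: "finitely_covered_balls av" and \<psi>: "nontrivial_additive_character av \<psi>\<^sub>0"
    and n: "1 \<le> n" and \<rho>: "smooth_rep av (n + 1) \<rho>" "generic \<psi>\<^sub>0 (n + 1) \<rho>"
    and \<eta>: "smooth_rep av (n - 1) \<eta>" and w: "w \<noteq> (0::'w)"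
  shows "twisted_jacquet_nonzero \<psi>\<^sub>0 n (induced_space av (n - 1) (n + 1) \<eta> \<rho>) (right_translation (2 * n))"
proof -
  obtain wh v where wh: "wh \<in> whittaker_functionals \<psi>\<^sub>0 (n + 1) \<rho>" "wh v \<noteq> 0"
    using whittaker_functional_exists[OF \<rho>(2)] .
  have lin: "clinear wh"
    using wh(1) by (simp add: whittaker_functionals_def)
  define l :: "('w, 'v) tensor \<Rightarrow> 'w" where "l = tensor_lift (\<lambda>w v. wh v *\<^sub>C w)"
  have l: "clinear l" and l_tensor: "l (w' \<otimes>\<^sub>C v') = wh v' *\<^sub>C w'" for v' w'
    using bilinear_scale(2)[OF lin, where 'w = 'w] by (simp_all add: l_def clinear_tensor_lift tensor_lift_tensor)
  define p where "p i = (if i < n - 1 then n + i else if i < 2 * n - 1 then i - (n - 1) else i)" for i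
  have "inj_on p {..<2 * n}"
    unfolding inj_on_def p_def using n by (auto split: if_splits)
  moreover have "p ` {..<2 * n} \<subseteq> {..<2 * n}"
    unfolding p_def using n by auto
  ultimately obtain g g' :: "'f mat" where g: "g \<in> GL (2 * n)" "g' \<in> GL (2 * n)" "g * g' = 1\<^sub>m (2 * n)"
    and conj: "\<And>M. M \<in> carrier_mat (2 * n) (2 * n) \<Longrightarrow>
      g * M * g' = Matrix.mat (2 * n) (2 * n) (\<lambda>(i, j). M $$ (p i, p j))"
    using permutation_matrix_conjugation[of p "2 * n"] by metis
  show ?thesis
  proof (rule twisted_jacquet_nonzero_from_orbit[OF cover \<psi> \<eta> \<rho>(1) _ g l, where v = w and w = v])
    show "n - 1 + (n + 1) = 2 * n" using n by simp
    show "l (w \<otimes>\<^sub>C v) \<noteq> 0"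
      using wh(2) w by (simp add: l_tensor)
    fix x :: "nat \<times> nat \<Rightarrow> 'f"
    define u where "u = Matrix.mat (n + 1) (n + 1)
      (\<lambda>(i, j). if i = j then 1 else if j = n then x (i, n - 1) else 0)"
    define Y where "Y = Matrix.mat (n + 1) (n - 1) (\<lambda>(i, j). if i < n then x (i, j) else 0)"
    have u: "u \<in> unipotent_upper (n + 1)"
      by (auto simp: unipotent_upper_def u_def)
    have uc: "u \<in> carrier_mat (n + 1) (n + 1)" and Yc: "Y \<in> carrier_mat (n + 1) (n - 1)"
      by (simp_all add: u_def Y_def)
    have "(\<Sum>i<n + 1 - 1. u $$ (i, i + 1)) = (\<Sum>i<n. if i = n - 1 then x (n - 1, n - 1) else 0)"
      by (intro sum.cong) (auto simp: u_def)
    also have "\<dots> = x (n - 1, n - 1)"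
      using n by (simp add: sum.delta)
    finally have "wh (\<rho> u v) = \<psi>\<^sub>0 (x (n - 1, n - 1)) * wh v"
      using wh(1) u by (simp add: whittaker_functionals_def whittaker_character_def)
    moreover have "\<eta> (1\<^sub>m (n - 1)) w = w"
      using \<eta> by (simp add: smooth_rep_def)
    ultimately have l_u: "l (\<eta> (1\<^sub>m (n - 1)) w \<otimes>\<^sub>C \<rho> u v) = \<psi>\<^sub>0 (x (n - 1, n - 1)) *\<^sub>C l (w \<otimes>\<^sub>C v)"
      by (simp add: l_tensor scaleC_scaleC)
    have uY: "u * Y = Y"
    proof (intro eq_matI)
      fix i j assume "i < dim_row Y" "j < dim_col Y"
      then have ij: "i < n + 1" "j < n - 1" using Yc by auto
      have "(u * Y) $$ (i, j) = (\<Sum>k = 0..<n + 1. u $$ (i, k) * Y $$ (k, j))"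
        using ij uc Yc by (simp add: scalar_prod_def)
      also have "\<dots> = (\<Sum>k = 0..<n + 1. if k = i then Y $$ (i, j) else 0)"
        using ij by (intro sum.cong) (auto simp: u_def Y_def)
      finally show "(u * Y) $$ (i, j) = Y $$ (i, j)"
        using ij by (simp add: sum.delta)
    qed (use uc Yc in auto)
    have "g * upper_unipotent n x * g' = four_block_mat (1\<^sub>m (n - 1)) (0\<^sub>m (n - 1) (n + 1)) Y u"
      unfolding conj[OF upper_unipotent_carrier]
    proof (intro eq_matI)
      let ?B = "four_block_mat (1\<^sub>m (n - 1)) (0\<^sub>m (n - 1) (n + 1)) Y u"
      fix i j assume "i < dim_row ?B" "j < dim_col ?B"
      then have ij: "i < 2 * n" "j < 2 * n"
        using uc n by auto
      then have pij: "p i < 2 * n" "p j < 2 * n"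
        using n by (auto simp: p_def)
      obtain m where m: "n = Suc m"
        using n by (cases n) auto
      have split: "i < m \<or> (\<exists>k\<le>m. i = m + k) \<or> i = 2 * m + 1" if "i < 2 * n" for i
        using that m by presburger
      have "?B $$ (i, j) = (if p i < n \<and> n \<le> p j then x (p i, p j - n) else if p i = p j then 1 else 0)"
        using split[OF ij(1)] split[OF ij(2)]
        by (elim disjE exE conjE) (simp_all add: p_def u_def Y_def m)
      moreover have "Matrix.mat (2 * n) (2 * n) (\<lambda>(i, j). upper_unipotent n x $$ (p i, p j)) $$ (i, j) =
          upper_unipotent n x $$ (p i, p j)"
        using ij by simp
      ultimately show "Matrix.mat (2 * n) (2 * n) (\<lambda>(i, j). upper_unipotent n x $$ (p i, p j)) $$ (i, j) = ?B $$ (i, j)"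
        by (simp only: upper_unipotent_entry[OF pij])
    qed (use uc n in auto)
    also have "\<dots> = cell_point (1\<^sub>m (n - 1)) (0\<^sub>m (n - 1) (n + 1)) u Y"
      unfolding cell_point_def uY using Yc by simp
    finally have eq: "g * upper_unipotent n x * g' = cell_point (1\<^sub>m (n - 1)) (0\<^sub>m (n - 1) (n + 1)) u Y" .
    have trace: "av (index_trace n x - x (n - 1, n - 1)) \<le> \<epsilon>" if \<epsilon>: "0 \<le> \<epsilon>" "mat_bounded \<epsilon> Y" for \<epsilon>
    proof -
      have trace_eq: "index_trace n x - x (n - 1, n - 1) = (\<Sum>i\<in>{..<n} - {n - 1}. x (i, i))"
        using n by (simp add: index_trace_def sum_diff1)
      have entries: "av (x (i, i)) \<le> \<epsilon>" if "i \<in> {..<n} - {n - 1}" for i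
      proof -
        have i: "i < n - 1" "i < n" using that by auto
        then have "av (Y $$ (i, i)) \<le> \<epsilon>"
          using \<epsilon>(2) Yc by (auto simp: mat_bounded_def)
        then show ?thesis
          using i by (simp add: Y_def)
      qed
      show ?thesis
        unfolding trace_eq by (rule av_sum_le[OF \<epsilon>(1) entries])
    qed
    show "\<exists>u\<^sub>1\<in>GL (n - 1). \<exists>u\<^sub>2\<in>GL (n + 1). \<exists>Y\<in>carrier_mat (n + 1) (n - 1). \<exists>s.
      det u\<^sub>1 = 1 \<and> det u\<^sub>2 = 1 \<and>
      g * upper_unipotent n x * g' = cell_point u\<^sub>1 (0\<^sub>m (n - 1) (n + 1)) u\<^sub>2 Y \<and>
      l (\<eta> u\<^sub>1 w \<otimes>\<^sub>C \<rho> u\<^sub>2 v) = \<psi>\<^sub>0 s *\<^sub>C l (w \<otimes>\<^sub>C v) \<and>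
      (\<forall>\<epsilon>\<ge>0. mat_bounded \<epsilon> Y \<longrightarrow> av (index_trace n x - s) \<le> \<epsilon>)"
      using unipotent_upper_det[OF u] Yc eq l_u trace
      by (intro bexI[of _ "1\<^sub>m (n - 1)"] bexI[of _ u] bexI[of _ Y] exI[of _ "x (n - 1, n - 1)"] conjI allI impI)
        (simp_all only: det_one one_in_GL)
  qed
qed

end

theorem theorem1p7:
  fixes av :: "'f::field \<Rightarrow> real"
    and \<psi>\<^sub>0 :: "'f \<Rightarrow> complex"
    and n :: nat
    and \<rho> :: "'f mat \<Rightarrow> 'v::complex_vector \<Rightarrow> 'v"
    and \<eta> :: "'f mat \<Rightarrow> 'w::complex_vector \<Rightarrow> 'w"
  assumes "nonarch_local_field av \<or> finite_field av"
    and "nontrivial_additive_character av \<psi>\<^sub>0"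
    and "n \<ge> 2"
    and "irreducible_smooth_rep av (n + 1) \<rho>"
    and "generic \<psi>\<^sub>0 (n + 1) \<rho>"
    and "irreducible_smooth_rep av (n - 1) \<eta>"
  shows "twisted_jacquet_nonzero \<psi>\<^sub>0 n
           (induced_space av (n + 1) (n - 1) \<rho> \<eta>) (right_translation (2 * n)) \<and>
         twisted_jacquet_nonzero \<psi>\<^sub>0 n
           (induced_space av (n - 1) (n + 1) \<eta> \<rho>) (right_translation (2 * n))"
proof -
  have field: "ultrametric_field av" "finitely_covered_balls av"
    using assms(1) finite_field_ultrametric nonarch_local_field_ultrametric
      nonarch_local_field_finitely_covered by blast+
  interpret ultrametric_field av by (rule field)
  have reps: "smooth_rep av (n + 1) \<rho>" "smooth_rep av (n - 1) \<eta>"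
    using assms(4,6) by (simp_all add: irreducible_smooth_rep_def)
  obtain w :: 'w where "w \<noteq> 0"
    using assms(6) unfolding irreducible_smooth_rep_def by blast
  moreover have "1 \<le> n" using assms(3) by simp
  ultimately show ?thesis
    using twisted_jacquet_nonzero_generic_first twisted_jacquet_nonzero_generic_second
      field(2) assms(2,5) reps by blast
qed

end
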